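(* Brave and cautious query answering for finitely recursive queries over $\mathrm{ASP^{fs}}$ programs is decidable: there is an algorithm which, given an $\mathrm{ASP^{fs}}$ program $\mathcal{P}$ and a query $\mathcal{Q}$ that is finitely recursive on $\mathcal{P}$, decides whether $\mathcal{P}$ cautiously entails $\mathcal{Q}$, and likewise there is an algorithm which decides whether $\mathcal{P}$ bravely entails $\mathcal{Q}$.
   Context: Terms are variables or functional terms $f(t_1,\dots,t_k)$ ($f$ a function symbol of arity $k\ge 0$; arity-0 function symbols are constants). An atom is $p(t_1,\dots,t_k)$ for a predicate $p$. A rule $r$ has the form $a_1 \vee \dots \vee a_n \leftarrow b_1,\dots,b_j,\mathrm{not}\,b_{j+1},\dots,\mathrm{not}\,b_m$ with atoms $a_i,b_i$, $n\ge1$, $m\ge j\ge 0$; $H(r)=\{a_1,\dots,a_n\}$, $B^+(r)=\{b_1,\dots,b_j\}$, $B^-(r)=\{b_{j+1},\dots,b_m\}$, $\mathrm{atoms}(r)=H(r)\cup B^+(r)\cup B^-(r)$. A program is a finite set of rules. A predicate $p$ depends on $q$ if some rule has a $p$-atom in its head and a $q$-atom in its body (positively if in $B^+$, negatively if in $B^-$); a program is stratified if no cycle of dependencies contains a negative dependency. An $\mathrm{ASP^{fs}}$ program is a stratified program (disjunction and function symbols allowed). The universe $U_\mathcal{P}$ is the set of ground terms built from function symbols of $\mathcal{P}$, the base $B_\mathcal{P}$ the set of ground atoms built from predicates of $\mathcal{P}$ and $U_\mathcal{P}$, and $\mathrm{Ground}(\mathcal{P})$ the set of all ground instances of rules of $\mathcal{P}$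 over $U_\mathcal{P}$. An interpretation $I\subseteq B_\mathcal{P}$ is a model if for every $r_g\in\mathrm{Ground}(\mathcal{P})$ with $B^+(r_g)\subseteq I$ and $B^-(r_g)\cap I=\emptyset$ we have $H(r_g)\cap I\neq\emptyset$. The reduct $\mathrm{Ground}(\mathcal{P})^I$ is obtained by deleting rules $r_g$ with $B^-(r_g)\cap I\neq\emptyset$ and removing negative literals from the rest; $M$ is a stable model iff $M$ is a subset-minimal model of $\mathrm{Ground}(\mathcal{P})^M$. A query is a ground atom $\mathcal{Q}$ (whose function symbols occur in $\mathcal{P}$); $\mathcal{P}$ cautiously (bravely) entails $\mathcal{Q}$ iff $\mathcal{Q}$ belongs to every (some) stable model of $\mathcal{P}$. The atoms relevant for $\mathcal{Q}$ are $\mathcal{Q}$ itself and every atom of $\mathrm{atoms}(r_g)$ for each $r_g\in\mathrm{Ground}(\mathcal{P})$ having some relevant atom in $H(r_g)$; $\mathcal{Q}$ is finitely recursive on $\mathcal{P}$ if only finitely many ground atoms are relevant for $\mathcal{Q}$. *)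

theory Defs
  imports Main "HOL-Library.Nat_Bijection"
begin

text \<open>
  Symbols are named by natural numbers. A function or predicate symbol is a pair of a name and
  an arity, the arity being read off from the number of arguments, so that the same name used with
  two different arities denotes two different symbols. Constants are function symbols of arity 0.
\<close>

type_synonym symbol = "nat \<times> nat"

datatype trm = Var nat | Fun nat "trm list"

datatype atm = Atom nat "trm list"

text \<open>
  The three lists are the head atoms, the positive body atoms and the atoms of the negative body
  literals. Only their sets of elements matter for the semantics.
\<close>

datatype rule = Rule (head_list: "atm list") (pos_list: "atm list") (neg_list: "atm list")

definition head :: "rule \<Rightarrow> atm set" where
  "head r = set (head_list r)"

definition body_pos :: "rule \<Rightarrow> atm set" where
  "body_pos r = set (pos_list r)"

definition body_neg :: "rule \<Rightarrow> atm set" where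
  "body_neg r = set (neg_list r)"

definition atoms :: "rule \<Rightarrow> atm set" where
  "atoms r = head r \<union> body_pos r \<union> body_neg r"

fun vars_trm :: "trm \<Rightarrow> nat set" where
  "vars_trm (Var x) = {x}"
| "vars_trm (Fun f ts) = (\<Union>t\<in>set ts. vars_trm t)"

fun funs_trm :: "trm \<Rightarrow> symbol set" where
  "funs_trm (Var x) = {}"
| "funs_trm (Fun f ts) = insert (f, length ts) (\<Union>t\<in>set ts. funs_trm t)"

fun vars_atm :: "atm \<Rightarrow> nat set" where
  "vars_atm (Atom p ts) = (\<Union>t\<in>set ts. vars_trm t)"

fun funs_atm :: "atm \<Rightarrow> symbol set" where
  "funs_atm (Atom p ts) = (\<Union>t\<in>set ts. funs_trm t)"

fun pred_atm :: "atm \<Rightarrow> symbol" where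
  "pred_atm (Atom p ts) = (p, length ts)"

definition vars_rule :: "rule \<Rightarrow> nat set" where
  "vars_rule r = (\<Union>a\<in>atoms r. vars_atm a)"

definition funs_program :: "rule set \<Rightarrow> symbol set" where
  "funs_program P = (\<Union>r\<in>P. \<Union>a\<in>atoms r. funs_atm a)"

definition preds_program :: "rule set \<Rightarrow> symbol set" where
  "preds_program P = (\<Union>r\<in>P. pred_atm ` atoms r)"

definition pos_dep :: "rule set \<Rightarrow> (symbol \<times> symbol) set" where
  "pos_dep P = {(pred_atm a, pred_atm b) | a b. \<exists>r\<in>P. a \<in> head r \<and> b \<in> body_pos r}"

definition neg_dep :: "rule set \<Rightarrow> (symbol \<times> symbol) set" where
  "neg_dep P = {(pred_atm a, pred_atm b) | a b. \<exists>r\<in>P. a \<in> head r \<and> b \<in> body_neg r}"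

text \<open>
  A cycle through a negative dependency of p on q consists of that dependency followed by a chain
  of dependencies leading from q back to p.
\<close>

definition stratified :: "rule set \<Rightarrow> bool" where
  "stratified P \<longleftrightarrow> (\<nexists>p q. (p, q) \<in> neg_dep P \<and> (q, p) \<in> (pos_dep P \<union> neg_dep P)\<^sup>*)"

definition asp_fs :: "rule set \<Rightarrow> bool" where
  "asp_fs P \<longleftrightarrow> finite P \<and> (\<forall>r\<in>P. head r \<noteq> {}) \<and> stratified P"

definition universe :: "rule set \<Rightarrow> trm set" where
  "universe P = {t. vars_trm t = {} \<and> funs_trm t \<subseteq> funs_program P}"

definition base :: "rule set \<Rightarrow> atm set" where
  "base P = {Atom p ts | p ts. (p, length ts) \<in> preds_program P \<and> set ts \<subseteq> universe P}"

fun subst_trm :: "(nat \<Rightarrow> trm) \<Rightarrow> trm \<Rightarrow> trm" where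
  "subst_trm \<sigma> (Var x) = \<sigma> x"
| "subst_trm \<sigma> (Fun f ts) = Fun f (map (subst_trm \<sigma>) ts)"

fun subst_atm :: "(nat \<Rightarrow> trm) \<Rightarrow> atm \<Rightarrow> atm" where
  "subst_atm \<sigma> (Atom p ts) = Atom p (map (subst_trm \<sigma>) ts)"

fun subst_rule :: "(nat \<Rightarrow> trm) \<Rightarrow> rule \<Rightarrow> rule" where
  "subst_rule \<sigma> (Rule hs ps ns) =
     Rule (map (subst_atm \<sigma>) hs) (map (subst_atm \<sigma>) ps) (map (subst_atm \<sigma>) ns)"

text \<open>
  The side condition only concerns the variables of the rule: if the program has no constants, its
  universe is empty and precisely the variable-free rules have a (single) ground instance.
\<close>

definition Ground :: "rule set \<Rightarrow> rule set" where
  "Ground P = {subst_rule \<sigma> r | \<sigma> r. r \<in> P \<and> \<sigma> ` vars_rule r \<subseteq> universe P}"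

definition satisfies :: "atm set \<Rightarrow> rule set \<Rightarrow> bool" where
  "satisfies I G \<longleftrightarrow>
     (\<forall>r\<in>G. body_pos r \<subseteq> I \<and> body_neg r \<inter> I = {} \<longrightarrow> head r \<inter> I \<noteq> {})"

definition reduct :: "rule set \<Rightarrow> atm set \<Rightarrow> rule set" where
  "reduct G I = {Rule (head_list r) (pos_list r) [] | r. r \<in> G \<and> body_neg r \<inter> I = {}}"

definition stable_model :: "rule set \<Rightarrow> atm set \<Rightarrow> bool" where
  "stable_model P M \<longleftrightarrow>
     M \<subseteq> base P \<and> satisfies M (reduct (Ground P) M) \<and>
     (\<forall>N. N \<subset> M \<longrightarrow> \<not> satisfies N (reduct (Ground P) M))"

definition query :: "rule set \<Rightarrow> atm \<Rightarrow> bool" where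
  "query P Q \<longleftrightarrow> vars_atm Q = {} \<and> funs_atm Q \<subseteq> funs_program P"

definition cautiously_entails :: "rule set \<Rightarrow> atm \<Rightarrow> bool" where
  "cautiously_entails P Q \<longleftrightarrow> (\<forall>M. stable_model P M \<longrightarrow> Q \<in> M)"

definition bravely_entails :: "rule set \<Rightarrow> atm \<Rightarrow> bool" where
  "bravely_entails P Q \<longleftrightarrow> (\<exists>M. stable_model P M \<and> Q \<in> M)"

inductive_set relevant :: "rule set \<Rightarrow> atm \<Rightarrow> atm set" for P Q where
  self: "Q \<in> relevant P Q"
| step: "\<lbrakk>a \<in> relevant P Q; r \<in> Ground P; a \<in> head r; b \<in> atoms r\<rbrakk> \<Longrightarrow> b \<in> relevant P Q"

definition finitely_recursive :: "rule set \<Rightarrow> atm \<Rightarrow> bool" where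
  "finitely_recursive P Q \<longleftrightarrow> finite (relevant P Q)"

text \<open>
  Algorithms are terms for partial recursive functions. The relation below says that the evaluation
  of such a term on a list of arguments terminates with the given result. Terms carry no fixed arity:
  the constant zero accepts every list of arguments, and a projection every list that is long enough.
  In primitive recursion and minimisation the distinguished argument comes first.
\<close>

datatype recf = Zero | Succ | Proj nat | Comp recf "recf list" | PrimRec recf recf | Mu recf

inductive computes :: "recf \<Rightarrow> nat list \<Rightarrow> nat \<Rightarrow> bool" where
  zero: "computes Zero xs 0"
| succ: "computes Succ [x] (Suc x)"
| proj: "i < length xs \<Longrightarrow> computes (Proj i) xs (xs ! i)"
| comp: "\<lbrakk>list_all2 (\<lambda>g y. computes g xs y) gs ys; computes f ys z\<rbrakk> \<Longrightarrow> computes (Comp f gs) xs z"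
| prim_0: "computes f xs z \<Longrightarrow> computes (PrimRec f g) (0 # xs) z"
| prim_Suc: "\<lbrakk>computes (PrimRec f g) (n # xs) y; computes g (n # y # xs) z\<rbrakk>
    \<Longrightarrow> computes (PrimRec f g) (Suc n # xs) z"
| mu: "\<lbrakk>computes f (n # xs) 0; \<forall>m<n. \<exists>y. computes f (m # xs) (Suc y)\<rbrakk>
    \<Longrightarrow> computes (Mu f) xs n"

inductive_cases computesE:
  "computes Zero xs z"
  "computes Succ xs z"
  "computes (Proj i) xs z"
  "computes (Comp f gs) xs z"
  "computes (PrimRec f g) (0 # xs) z"
  "computes (PrimRec f g) (Suc n # xs) z"
  "computes (Mu f) xs z"

lemma computes_deterministic:
  "computes f xs y \<Longrightarrow> computes f xs z \<Longrightarrow> y = z"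
proof (induction arbitrary: z rule: computes.induct)
  case (zero xs)
  then show ?case by (rule computesE(1)) simp
next
  case (succ x)
  then show ?case by (rule computesE(2)) simp
next
  case (proj i xs)
  from proj.prems show ?case by (rule computesE(3)) simp
next
  case (comp xs gs ys f w)
  from comp.prems obtain ys' where
    ys': "list_all2 (\<lambda>g y. computes g xs y) gs ys'" and z: "computes f ys' z"
    by (rule computesE(4))
  have "ys = ys'"
  proof (rule nth_equalityI)
    show "length ys = length ys'"
      using comp.IH(1) ys' by (simp add: list_all2_conv_all_nth)
    show "ys ! i = ys' ! i" if "i < length ys" for i
      using comp.IH(1) ys' that by (simp add: list_all2_conv_all_nth)
  qed
  then show ?case using comp.IH(2) z by simp
next
  case (prim_0 f xs w g)
  from prim_0.prems show ?case by (rule computesE(5)) (rule prim_0.IH)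
next
  case (prim_Suc f g n xs y w)
  from prim_Suc.prems obtain y' where
    y': "computes (PrimRec f g) (n # xs) y'" "computes g (n # y' # xs) z"
    by (rule computesE(6))
  have "y = y'" using y'(1) by (rule prim_Suc.IH)
  then show ?case using y'(2) prim_Suc.IH(2) by simp
next
  case (mu f n xs)
  have z: "computes f (z # xs) 0 \<and> (\<forall>m<z. \<exists>y. computes f (m # xs) (Suc y))"
    using mu.prems by (rule computesE(7)) (intro conjI)
  have "\<not> n < z"
  proof
    assume "n < z"
    then obtain y where "computes f (n # xs) (Suc y)" using z by blast
    then have "0 = Suc y" by (rule mu.IH(1))
    then show False by simp
  qed
  moreover have "\<not> z < n"
  proof
    assume "z < n"
    then obtain y where "\<forall>x. computes f (z # xs) x \<longrightarrow> Suc y = x" using mu.IH(2) by blast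
    then have "Suc y = 0" using z by blast
    then show False by simp
  qed
  ultimately show ?case by simp
qed

fun code_trm :: "trm \<Rightarrow> nat" where
  "code_trm (Var x) = prod_encode (0, x)"
| "code_trm (Fun f ts) = prod_encode (1, prod_encode (f, list_encode (map code_trm ts)))"

fun code_atm :: "atm \<Rightarrow> nat" where
  "code_atm (Atom p ts) = prod_encode (p, list_encode (map code_trm ts))"

fun code_rule :: "rule \<Rightarrow> nat" where
  "code_rule (Rule hs ps ns) =
     prod_encode (list_encode (map code_atm hs),
       prod_encode (list_encode (map code_atm ps), list_encode (map code_atm ns)))"

definition code_program :: "rule list \<Rightarrow> nat" where
  "code_program rs = list_encode (map code_rule rs)"

lemma code_trm_inject: "code_trm s = code_trm t \<Longrightarrow> s = t"
proof (induction s arbitrary: t)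
  case (Var x)
  then show ?case by (cases t) auto
next
  case (Fun f ss)
  then obtain ts where t: "t = Fun f ts" and "map code_trm ss = map code_trm ts"
    by (cases t) (auto simp: list_encode_eq)
  then have "ss = ts"
    using Fun.IH by (metis (mono_tags, lifting) list.inj_map_strong)
  then show ?case using t by simp
qed

lemma inj_code_trm: "inj code_trm"
  by (auto intro: injI code_trm_inject)

lemma inj_code_atm: "inj code_atm"
proof (rule injI)
  fix a b assume "code_atm a = code_atm b"
  then show "a = b"
    by (cases a; cases b)
      (auto simp: list_encode_eq inj_map_eq_map[OF inj_code_trm])
qed

lemma inj_code_rule: "inj code_rule"
proof (rule injI)
  fix r s assume "code_rule r = code_rule s"
  then show "r = s"
    by (cases r; cases s)
      (auto simp: list_encode_eq inj_map_eq_map[OF inj_code_atm])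
qed

lemma inj_code_program: "inj code_program"
  by (rule injI) (simp add: code_program_def list_encode_eq inj_map_eq_map[OF inj_code_rule])

text \<open>
  The finite set of rules is presented to the algorithm as any list enumerating it. Nothing is
  required, not even termination, on inputs that violate the three assumptions.
\<close>

definition decides_finitely_recursive :: "recf \<Rightarrow> (rule set \<Rightarrow> atm \<Rightarrow> bool) \<Rightarrow> bool" where
  "decides_finitely_recursive f entails \<longleftrightarrow>
     (\<forall>rs Q. asp_fs (set rs) \<and> query (set rs) Q \<and> finitely_recursive (set rs) Q \<longrightarrow>
        computes f [code_program rs, code_atm Q] (if entails (set rs) Q then 1 else 0))"

end

theory Submission
  imports Defs
begin

text \<open>
  The set R of atoms relevant for the query is a splitting set of the ground program: every rule
  with a head atom in R lies entirely within R. Stable models restrict to stable models of these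
  bottom rules. Conversely a stable model of the bottom rules extends to the whole program: replace
  the bottom rules by its atoms as facts and use that ground programs with a level mapping have
  stable models, obtained by minimising level by level (the head atoms of a rule need not have the
  same level). Hence both entailments only depend on the bottom rules, and these are finitely many
  if R is finite.

  The set R is enumerated in stages. An instance whose head meets the current stage can be found
  by substituting subterms of that stage and constants only: a variable not occurring in the matched
  head atom would otherwise make infinitely many atoms relevant, unless the universe is finite and
  thus consists of constants. The first stage to which nothing is added is R, so a single unbounded
  search followed by an exhaustive test of all subsets of R decides the query.
\<close>

text \<open>Stratification enters at one point, the passage from the bottom rules to the whole
  program: without a stable model above it, a stable model of the bottom rules could be a spurious
  witness or counterexample. The ground program may be infinite and disjunctive, so there is no
  least model to iterate towards; minimal models of the single levels come from Zorn's lemma, and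
  minimality is relative to the levels already fixed.

  The other obstacle is that \<open>recf\<close> recurses on numbers only. The algorithm is
  therefore written with ordinary HOL functions on lists, terms and rules, and
  \<open>computable\<close> is shown to be closed under the operations they use. Structural
  recursion on terms is not among these. It is replaced by iteration, and the code of the datum
  itself bounds the number of rounds, since arguments have smaller codes than their term and a list
  is no longer than its code. Apart from the decoding of pairs, the only unbounded search is the one
  for a saturated stage, and its termination is where the finiteness of the set of relevant atoms is
  essential.\<close>

section \<open>Computable functions between encoded types\<close>

lemma computes_Comp:
  assumes "list_all2 (\<lambda>g y. computes g xs y) gs ys" and "computes f ys z"
  shows "computes (Comp f gs) xs z"
  using assms by (rule computes.comp)

lemma computes_Comp1: "computes g xs y \<Longrightarrow> computes f [y] z \<Longrightarrow> computes (Comp f [g]) xs z"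
  by (rule computes_Comp[of _ _ "[y]"]) simp_all

lemma computes_Comp2:
  "computes g xs y \<Longrightarrow> computes h xs y' \<Longrightarrow> computes f [y, y'] z \<Longrightarrow> computes (Comp f [g, h]) xs z"
  by (rule computes_Comp[of _ _ "[y, y']"]) simp_all

lemma computes_Proj: "i < length xs \<Longrightarrow> z = xs ! i \<Longrightarrow> computes (Proj i) xs z"
  using computes.proj by simp

fun const_recf :: "nat \<Rightarrow> recf" where
  "const_recf 0 = Zero"
| "const_recf (Suc n) = Comp Succ [const_recf n]"

lemma computes_const: "computes (const_recf n) xs n"
  by (induction n) (auto intro: computes.zero computes.succ computes_Comp1)

definition add_recf :: recf where
  "add_recf = PrimRec (Proj 0) (Comp Succ [Proj 1])"

lemma computes_add: "computes add_recf (m # n # xs) (m + n)"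
  unfolding add_recf_def
proof (induction m)
  case (Suc m)
  show ?case
    by (rule computes.prim_Suc[OF Suc computes_Comp1[OF computes_Proj]]) (auto intro: computes.succ)
qed (auto intro!: computes.prim_0 computes_Proj)

definition pred_recf :: recf where
  "pred_recf = PrimRec Zero (Proj 0)"

lemma computes_pred: "computes pred_recf [n] (n - 1)"
  unfolding pred_recf_def
proof (induction n)
  case (Suc n)
  show ?case by (rule computes.prim_Suc[OF Suc]) (simp add: computes_Proj)
qed (auto intro: computes.prim_0 computes.zero)

text \<open>The recursion is on the subtrahend, which therefore comes first.\<close>

definition sub_recf :: recf where
  "sub_recf = PrimRec (Proj 0) (Comp pred_recf [Proj 1])"

lemma computes_sub: "computes sub_recf [m, n] (n - m)"
  unfolding sub_recf_def
proof (induction m)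
  case (Suc m)
  have "computes pred_recf [n - m] (n - Suc m)" using computes_pred[of "n - m"] by simp
  then show ?case
    by (intro computes.prim_Suc[OF Suc computes_Comp1[OF computes_Proj]]) simp_all
qed (auto intro!: computes.prim_0 computes_Proj)

definition triangle_recf :: recf where
  "triangle_recf = PrimRec Zero (Comp add_recf [Proj 1, Comp Succ [Proj 0]])"

lemma computes_triangle: "computes triangle_recf [n] (triangle n)"
  unfolding triangle_recf_def
proof (induction n)
  case (Suc n)
  have "computes add_recf [triangle n, Suc n] (triangle (Suc n))"
    using computes_add[of "triangle n" "Suc n" "[]"] by simp
  then show ?case
    by (intro computes.prim_Suc[OF Suc])
      (auto intro!: computes_Comp2 computes_Comp1 computes_Proj computes.succ)
qed (auto intro: computes.prim_0 computes.zero)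

definition pair_recf :: recf where
  "pair_recf = Comp add_recf [Comp triangle_recf [add_recf], Proj 0]"

text \<open>The tail \<open>xs\<close> lets the term run on a longer argument list and read only the
  first two entries; \<open>computable_rec_nat\<close> relies on this.\<close>

lemma computes_pair: "computes pair_recf (m # n # xs) (prod_encode (m, n))"
  unfolding pair_recf_def prod_encode_def
  by (auto intro!: computes_Comp2 computes_Comp1 computes_Proj computes_add computes_triangle)

lemma triangle_mono: "m \<le> n \<Longrightarrow> triangle m \<le> triangle n"
  by (induction n) (auto simp: le_Suc_eq)

text \<open>
  The sum of the components of a pair coded by n is the least s with
  n < triangle (Suc s).
\<close>

definition pair_sum_recf :: recf where
  "pair_sum_recf = Mu (Comp sub_recf [Comp triangle_recf [Comp Succ [Proj 0]], Comp Succ [Proj 1]])"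

lemma computes_pair_sum: "computes pair_sum_recf [prod_encode (a, b)] (a + b)"
proof -
  let ?n = "prod_encode (a, b)"
  let ?f = "Comp sub_recf [Comp triangle_recf [Comp Succ [Proj 0]], Comp Succ [Proj 1]]"
  \<comment> \<open>Truncated subtraction turns the inequality \<open>?n < triangle (Suc s)\<close>
    into the value 0, which is what \<open>Mu\<close> looks for.\<close>
  have f: "computes ?f [s, ?n] (Suc ?n - triangle (Suc s))" for s
    by (rule computes_Comp2)
      (auto intro!: computes_Comp1 computes_Proj computes.succ computes_triangle computes_sub
          simp del: triangle_Suc)
  have "computes ?f [a + b, ?n] 0"
    using f[of "a + b"] by (simp add: prod_encode_def)
  moreover have "\<exists>y. computes ?f [s, ?n] (Suc y)" if "s < a + b" for s
  proof -
    have "triangle (Suc s) \<le> triangle (a + b)" using that by (intro triangle_mono) simp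
    then have "triangle (Suc s) \<le> ?n" unfolding prod_encode_def by simp
    then have "Suc ?n - triangle (Suc s) = Suc (?n - triangle (Suc s))" by simp
    then show ?thesis using f[of s] by metis
  qed
  ultimately show ?thesis unfolding pair_sum_recf_def by (intro computes.mu) auto
qed

definition fst_recf :: recf where
  "fst_recf = Comp sub_recf [Comp triangle_recf [pair_sum_recf], Proj 0]"

lemma computes_fst: "computes fst_recf [prod_encode (a, b)] a"
proof -
  have "computes sub_recf [triangle (a + b), prod_encode (a, b)] a"
    using computes_sub[of "triangle (a + b)" "prod_encode (a, b)"] by (simp add: prod_encode_def)
  then show ?thesis
    unfolding fst_recf_def
    by (auto intro!: computes_Comp2 computes_Comp1 computes_pair_sum computes_triangle computes_Proj)
qed

definition snd_recf :: recf where
  "snd_recf = Comp sub_recf [fst_recf, pair_sum_recf]"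

lemma computes_snd: "computes snd_recf [prod_encode (a, b)] b"
proof -
  have "computes sub_recf [a, a + b] b" using computes_sub[of a "a + b"] by simp
  then show ?thesis
    unfolding snd_recf_def by (auto intro!: computes_Comp2 computes_fst computes_pair_sum)
qed

section \<open>Types with an injective coding by natural numbers\<close>

class encodable =
  fixes enc :: "'a \<Rightarrow> nat"
  assumes enc_eq_iff [simp]: "enc x = enc y \<longleftrightarrow> x = y"

instantiation nat :: encodable
begin
definition enc_nat :: "nat \<Rightarrow> nat" where [simp]: "enc_nat n = n"
instance by standard simp
end

instantiation bool :: encodable
begin
definition enc_bool :: "bool \<Rightarrow> nat" where "enc_bool b = (if b then 1 else 0)"
instance by standard (simp add: enc_bool_def)
end

instantiation prod :: (encodable, encodable) encodable
begin
definition enc_prod :: "'a \<times> 'b \<Rightarrow> nat" where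
  "enc_prod p = prod_encode (enc (fst p), enc (snd p))"
instance by standard (simp add: enc_prod_def prod_eq_iff)
end

instantiation list :: (encodable) encodable
begin
definition enc_list :: "'a list \<Rightarrow> nat" where "enc_list xs = list_encode (map enc xs)"
instance
proof
  have "inj (enc :: 'a \<Rightarrow> nat)" by (rule injI) simp
  then show "enc xs = enc ys \<longleftrightarrow> xs = ys" for xs ys :: "'a list"
    by (simp add: enc_list_def list_encode_eq inj_map_eq_map)
qed
end

instantiation trm :: encodable
begin
definition enc_trm :: "trm \<Rightarrow> nat" where "enc_trm = code_trm"
instance by standard (auto simp: enc_trm_def intro: code_trm_inject)
end

instantiation atm :: encodable
begin
definition enc_atm :: "atm \<Rightarrow> nat" where "enc_atm = code_atm"
instance by standard (auto simp: enc_atm_def inj_eq[OF inj_code_atm])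
end

instantiation rule :: encodable
begin
definition enc_rule :: "rule \<Rightarrow> nat" where "enc_rule = code_rule"
instance by standard (auto simp: enc_rule_def inj_eq[OF inj_code_rule])
end

lemma enc_Pair: "enc (x, y) = prod_encode (enc x, enc y)"
  by (simp add: enc_prod_def)

lemma enc_Nil: "enc [] = 0"
  by (simp add: enc_list_def)

lemma enc_Cons: "enc (x # xs) = Suc (prod_encode (enc x, enc xs))"
  by (simp add: enc_list_def)

lemma enc_Var: "enc (Var x) = prod_encode (0, x)"
  by (simp add: enc_trm_def)

lemma enc_Fun: "enc (Fun f ts) = prod_encode (1, prod_encode (f, enc ts))"
  by (simp add: enc_trm_def enc_list_def)

lemma enc_Atom: "enc (Atom p ts) = prod_encode (p, enc ts)"
  by (simp add: enc_trm_def enc_atm_def enc_list_def)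

lemma enc_Rule: "enc (Rule hs ps ns) = prod_encode (enc hs, prod_encode (enc ps, enc ns))"
  by (simp add: enc_rule_def enc_atm_def enc_list_def)

lemma code_program_eq_enc: "code_program rs = enc rs"
  by (simp add: code_program_def enc_list_def enc_rule_def)

lemma code_atm_eq_enc: "code_atm a = enc a"
  by (simp add: enc_atm_def)

section \<open>Computability of functions on coded types and its closure properties\<close>

text \<open>The realizing term has to be correct on codes only and may diverge elsewhere. Functions
  of several arguments are treated as functions of tuples.\<close>

definition computable :: "('a::encodable \<Rightarrow> 'b::encodable) \<Rightarrow> bool" where
  "computable f \<longleftrightarrow> (\<exists>r. \<forall>x. computes r [enc x] (enc (f x)))"

lemma computableI: "(\<And>x. computes r [enc x] (enc (f x))) \<Longrightarrow> computable f"
  by (auto simp: computable_def)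

text \<open>\<open>f\<close> and \<open>g\<close> may have different result types. A function that
  changes the type but not the code, such as the passage from a triple of lists to a rule, is thus
  computable at once.\<close>

lemma computable_enc_cong:
  assumes "computable g" and "\<And>x. enc (f x) = enc (g x)"
  shows "computable f"
  using assms by (auto simp: computable_def)

lemma computable_comp:
  assumes "computable f" and "computable g"
  shows "computable (\<lambda>x. f (g x))"
proof -
  from assms obtain r s where
    "\<And>x. computes r [enc x] (enc (f x))" "\<And>x. computes s [enc x] (enc (g x))"
    unfolding computable_def by blast
  then have "computes (Comp r [s]) [enc x] (enc (f (g x)))" for x
    by (blast intro: computes_Comp1)
  then show ?thesis by (rule computableI)
qed

lemma computable_id: "computable (\<lambda>x. x)"
  by (rule computableI[of "Proj 0"]) (simp add: computes_Proj)

lemma computable_const: "computable (\<lambda>_. c)"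
  by (rule computableI[OF computes_const])

lemma computable_Pair:
  assumes "computable f" and "computable g"
  shows "computable (\<lambda>x. (f x, g x))"
proof -
  from assms obtain r s where
    "\<And>x. computes r [enc x] (enc (f x))" "\<And>x. computes s [enc x] (enc (g x))"
    unfolding computable_def by blast
  then have "computes (Comp pair_recf [r, s]) [enc x] (enc (f x, g x))" for x
    unfolding enc_Pair by (blast intro: computes_Comp2 computes_pair)
  then show ?thesis by (rule computableI)
qed

lemma computable_fst: "computable f \<Longrightarrow> computable (\<lambda>x. fst (f x))"
  by (rule computable_comp[of fst])
    (auto intro!: computableI[of fst_recf] simp: enc_Pair computes_fst)

lemma computable_snd: "computable f \<Longrightarrow> computable (\<lambda>x. snd (f x))"
  by (rule computable_comp[of snd])
    (auto intro!: computableI[of snd_recf] simp: enc_Pair computes_snd)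

lemma computable_enc: "computable f \<Longrightarrow> computable (\<lambda>x. enc (f x))"
  by (rule computable_enc_cong) simp_all

lemma computable_comp2:
  assumes "computable (\<lambda>p. h (fst p) (snd p))" and "computable f" and "computable g"
  shows "computable (\<lambda>x. h (f x) (g x))"
  using computable_comp[OF assms(1) computable_Pair[OF assms(2,3)]] by simp

lemma computable_binary_recf:
  fixes h :: "'a::encodable \<Rightarrow> 'b::encodable \<Rightarrow> 'c::encodable"
  assumes "\<And>a b. computes r [enc a, enc b] (enc (h a b))"
    and "computable f" and "computable g"
  shows "computable (\<lambda>x. h (f x) (g x))"
proof (rule computable_comp2[OF _ assms(2,3)])
  have "computes (Comp r [fst_recf, snd_recf]) [enc p] (enc (h (fst p) (snd p)))" for p :: "'a \<times> 'b"
    using assms(1) by (cases p) (auto simp: enc_Pair intro!: computes_Comp2 computes_fst computes_snd)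
  then show "computable (\<lambda>p. h (fst p) (snd p))" by (rule computableI)
qed

lemma computable_plus:
  fixes f g :: "'a::encodable \<Rightarrow> nat"
  shows "computable f \<Longrightarrow> computable g \<Longrightarrow> computable (\<lambda>x. f x + g x)"
  by (rule computable_binary_recf) (auto intro: computes_add)

lemma computable_minus:
  fixes f g :: "'a::encodable \<Rightarrow> nat"
  assumes "computable f" and "computable g"
  shows "computable (\<lambda>x. f x - g x)"
  by (rule computable_binary_recf[where h = "\<lambda>a b. b - a", OF _ assms(2,1)])
    (auto intro: computes_sub)

lemma computable_rec_nat:
  fixes n :: "'x::encodable \<Rightarrow> nat" and z :: "'x \<Rightarrow> 'b::encodable"
  assumes "computable n" and "computable z"
    and s: "computable (\<lambda>p. s (fst p) (fst (snd p)) (snd (snd p)))"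
  shows "computable (\<lambda>x. rec_nat (z x) (s x) (n x))"
proof -
  from assms obtain rn rz rs where rn: "\<And>x. computes rn [enc x] (enc (n x))"
    and rz: "\<And>x. computes rz [enc x] (enc (z x))"
    and rs: "\<And>x. computes rs [enc x] (enc (s (fst x) (fst (snd x)) (snd (snd x))))"
    unfolding computable_def by blast
  \<comment> \<open>\<open>PrimRec\<close> supplies counter, previous value and parameter in this
    order; the step function expects the parameter first.\<close>
  let ?g = "Comp rs [Comp pair_recf [Proj 2, pair_recf]]"
  have g: "computes ?g [k, enc y, enc x] (enc (s x k y))" for k x y
  proof -
    have "computes (Comp pair_recf [Proj 2, pair_recf]) [k, enc y, enc x] (enc (x, (k, y)))"
      by (auto simp: enc_Pair intro!: computes_Comp2 computes_Proj computes_pair)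
    then show ?thesis using rs[of "(x, (k, y))"] by (auto intro: computes_Comp1)
  qed
  have "computes (PrimRec rz ?g) [m, enc x] (enc (rec_nat (z x) (s x) m))" for m x
  proof (induction m)
    case 0
    then show ?case using rz by (auto intro: computes.prim_0)
  next
    case (Suc m)
    show ?case using g by (auto intro: computes.prim_Suc[OF Suc])
  qed
  then have "computes (Comp (PrimRec rz ?g) [rn, Proj 0]) [enc x] (enc (rec_nat (z x) (s x) (n x)))" for x
    using rn[of x] by (auto intro!: computes_Comp2 computes_Proj)
  then show ?thesis by (rule computableI)
qed

text \<open>The code of the condition is 0 or 1, so a primitive recursion of that length selects the
  branch. The other branch may be evaluated as well, which is harmless because both functions are
  total.\<close>

lemma computable_if:
  assumes "computable b" and "computable f" and "computable g"
  shows "computable (\<lambda>x. if b x then f x else g x)"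
proof (rule computable_enc_cong)
  show "computable (\<lambda>x. rec_nat (g x) (\<lambda>_ _. f x) (enc (b x)))"
    by (intro computable_rec_nat computable_enc assms computable_comp[OF assms(2)]
        computable_fst computable_id)
  show "enc (if b x then f x else g x) = enc (rec_nat (g x) (\<lambda>_ _. f x) (enc (b x)))" for x
    by (simp add: enc_bool_def)
qed

lemma computable_not:
  assumes "computable b"
  shows "computable (\<lambda>x. \<not> b x)"
proof -
  have "(\<lambda>x. \<not> b x) = (\<lambda>x. if b x then False else True)" by auto
  then show ?thesis by (simp only: computable_if[OF assms computable_const computable_const])
qed

lemma computable_conj:
  assumes "computable b" and "computable c"
  shows "computable (\<lambda>x. b x \<and> c x)"
proof -
  have "(\<lambda>x. b x \<and> c x) = (\<lambda>x. if b x then c x else False)" by auto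
  then show ?thesis by (simp only: computable_if[OF assms computable_const])
qed

lemma computable_disj:
  assumes "computable b" and "computable c"
  shows "computable (\<lambda>x. b x \<or> c x)"
proof -
  have "(\<lambda>x. b x \<or> c x) = (\<lambda>x. if b x then True else c x)" by auto
  then show ?thesis by (simp only: computable_if[OF assms(1) computable_const assms(2)])
qed

text \<open>Since codes are injective, equality is the vanishing of both truncated differences of
  the codes.\<close>

lemma computable_eq:
  assumes "computable f" and "computable g"
  shows "computable (\<lambda>x. f x = g x)"
proof (rule computable_enc_cong)
  show "computable (\<lambda>x. 1 - ((enc (f x) - enc (g x)) + (enc (g x) - enc (f x))))"
    by (intro computable_minus computable_plus computable_const computable_enc assms)
  show "enc (f x = g x) = enc (1 - ((enc (f x) - enc (g x)) + (enc (g x) - enc (f x))))" for x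
  proof (cases "f x = g x")
    case False
    then have "enc (f x) \<noteq> enc (g x)" by simp
    then have "1 - ((enc (f x) - enc (g x)) + (enc (g x) - enc (f x))) = 0" by linarith
    then show ?thesis using False by (simp add: enc_bool_def)
  qed (simp add: enc_bool_def)
qed

lemma computable_Cons:
  assumes "computable f" and "computable g"
  shows "computable (\<lambda>x. f x # g x)"
  by (rule computable_enc_cong[OF computable_plus[OF computable_const[of 1]
          computable_enc[OF computable_Pair[OF assms]]]]) (simp add: enc_Cons enc_Pair)

text \<open>A primitive recursion on the code of the list that ignores the previous value acts as a
  case distinction between 0 and a successor. It still evaluates all smaller arguments, among which
  there may be numbers that code no list of this type, so \<open>r\<close> has to halt on every
  number. The value at \<open>[]\<close> enters as a constant, whatever it is; this covers
  \<open>hd []\<close>.\<close>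

lemma computable_list_dest:
  fixes h :: "'a::encodable list \<Rightarrow> 'b::encodable"
  assumes "\<And>x xs. computes r [enc (x # xs) - 1] (enc (h (x # xs)))"
    and r: "\<And>n. \<exists>y. computes r [n] y"
    and f: "computable f"
  shows "computable (\<lambda>x. h (f x))"
proof (rule computable_comp[OF _ f])
  let ?r = "PrimRec (const_recf (enc (h []))) (Comp r [Proj 0])"
  have pr: "\<exists>y. computes (PrimRec (const_recf c) (Comp r [Proj 0])) [n] y" for c n
  proof (induction n)
    case 0
    then show ?case by (auto intro: computes.prim_0 computes_const)
  next
    case (Suc n)
    obtain y where "computes r [n] y" using r by blast
    with Suc show ?case by (blast intro: computes.prim_Suc computes_Comp1 computes_Proj[of 0 "n # _", simplified])
  qed
  have "computes (PrimRec (const_recf (enc (h []))) (Comp r [Proj 0])) [enc xs] (enc (h xs))" for xs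
  proof (cases xs)
    case Nil
    then show ?thesis by (auto simp: enc_Nil intro: computes.prim_0 computes_const)
  next
    case (Cons a as)
    let ?m = "prod_encode (enc a, enc as)"
    obtain y where "computes ?r [?m] y" using pr by blast
    moreover have "computes (Comp r [Proj 0]) [?m, y] (enc (h xs))"
      using assms(1)[of a as] by (auto simp: Cons enc_Cons intro!: computes_Comp1 computes_Proj)
    ultimately show ?thesis unfolding Cons enc_Cons by (rule computes.prim_Suc)
  qed
  then show "computable h" by (rule computableI)
qed

lemma computes_fst_total: "\<exists>y. computes fst_recf [n] y"
  using computes_fst by (metis prod_decode_inverse surj_pair)

lemma computes_snd_total: "\<exists>y. computes snd_recf [n] y"
  using computes_snd by (metis prod_decode_inverse surj_pair)

lemma computable_hd: "computable f \<Longrightarrow> computable (\<lambda>x. hd (f x))"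
  by (rule computable_list_dest[where r = fst_recf])
    (simp_all add: enc_Cons computes_fst computes_fst_total)

lemma computable_tl: "computable f \<Longrightarrow> computable (\<lambda>x. tl (f x))"
  by (rule computable_list_dest[where r = snd_recf])
    (simp_all add: enc_Cons computes_snd computes_snd_total)

section \<open>List processing with the code of the list as a bound\<close>

lemma length_le_enc: "length xs \<le> enc xs"
proof (induction xs)
  case (Cons x xs)
  have "enc xs \<le> prod_encode (enc x, enc xs)" by (rule le_prod_encode_2)
  with Cons show ?case by (simp add: enc_Cons)
qed simp

lemma enc_le_enc_list: "x \<in> set xs \<Longrightarrow> enc x \<le> enc xs"
proof (induction xs)
  case (Cons y ys)
  have "enc ys \<le> prod_encode (enc y, enc ys)" "enc y \<le> prod_encode (enc y, enc ys)"
    by (rule le_prod_encode_2, rule le_prod_encode_1)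
  with Cons show ?case by (auto simp: enc_Cons)
qed simp

text \<open>The state is the pair of remaining list and accumulator. It is updated
  \<open>enc (l x)\<close> times, which suffices for all entries by \<open>length_le_enc\<close>;
  once the list is used up, the step is idle.\<close>

lemma computable_fold:
  fixes l :: "'x::encodable \<Rightarrow> 'a::encodable list" and z :: "'x \<Rightarrow> 'b::encodable"
  assumes h: "computable (\<lambda>p. h (fst p) (fst (snd p)) (snd (snd p)))"
    and l: "computable l" and z: "computable z"
  shows "computable (\<lambda>x. fold (\<lambda>a y. h x a y) (l x) (z x))"
proof -
  define step where "step x q =
    (if fst q = [] then q else (tl (fst q), h x (hd (fst q)) (snd q)))" for x and q :: "'a list \<times> 'b"
  have "computable (\<lambda>p. h (fst p) (hd (fst (snd (snd p)))) (snd (snd (snd p))))"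
    if "computable (\<lambda>p. h (fst p) (fst (snd p)) (snd (snd p)))"
    using computable_comp[OF that computable_Pair[OF computable_fst[OF computable_id]
          computable_Pair[OF computable_hd[OF computable_fst[OF computable_snd[OF computable_snd[OF computable_id]]]]
            computable_snd[OF computable_snd[OF computable_snd[OF computable_id]]]]]]
    by simp
  from this[OF h] have "computable (\<lambda>p :: 'x \<times> nat \<times> 'a list \<times> 'b. step (fst p) (snd (snd p)))"
    unfolding step_def
    by (intro computable_if computable_eq computable_const computable_Pair computable_tl
        computable_fst computable_snd computable_id)
  then have "computable (\<lambda>x. snd (rec_nat (l x, z x) (\<lambda>_ q. step x q) (enc (l x))))"
    by (intro computable_snd computable_rec_nat computable_enc computable_Pair l z)
  moreover have "rec_nat (xs, y) (\<lambda>_ q. step x q) n = (drop n xs, fold (h x) (take n xs) y)"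
    for x xs and y :: 'b and n
    by (induction n)
      (auto simp: step_def drop_Suc tl_drop take_Suc_conv_app_nth hd_drop_conv_nth)
  ultimately show ?thesis by (simp add: take_all[OF length_le_enc])
qed

lemma computable_rev:
  fixes l :: "'x::encodable \<Rightarrow> 'a::encodable list"
  assumes "computable l"
  shows "computable (\<lambda>x. rev (l x))"
proof -
  have "computable (\<lambda>x. fold (\<lambda>a y. a # y) (l x) [])"
    by (intro computable_fold computable_Cons computable_const computable_fst computable_snd
        computable_id assms)
  moreover have "fold (\<lambda>a y. a # y) xs [] = rev xs" for xs :: "'a list"
    using rev_conv_fold[of xs] by simp
  ultimately show ?thesis by simp
qed

lemma computable_foldr:
  fixes l :: "'x::encodable \<Rightarrow> 'a::encodable list" and z :: "'x \<Rightarrow> 'b::encodable"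
  assumes "computable (\<lambda>p. h (fst p) (fst (snd p)) (snd (snd p)))"
    and "computable l" and "computable z"
  shows "computable (\<lambda>x. foldr (\<lambda>a y. h x a y) (l x) (z x))"
  unfolding foldr_conv_fold by (intro computable_fold computable_rev assms)

lemmas computable_intros =
  computable_id computable_const computable_Pair computable_fst computable_snd computable_if
  computable_not computable_conj computable_disj computable_eq computable_Cons computable_hd
  computable_tl computable_enc

lemma computable_fun_fst_snd:
  assumes "computable (\<lambda>p. h (fst p) (snd p))"
  shows "computable (\<lambda>p. h (fst p) (fst (snd p)))"
  using computable_comp2[OF assms computable_fst[OF computable_id]
      computable_fst[OF computable_snd[OF computable_id]]] .

lemma computable_map:
  fixes h :: "'x::encodable \<Rightarrow> 'a::encodable \<Rightarrow> 'b::encodable"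
  assumes "computable (\<lambda>p. h (fst p) (snd p))" and "computable l"
  shows "computable (\<lambda>x. map (\<lambda>a. h x a) (l x))"
proof -
  have "computable (\<lambda>x. foldr (\<lambda>a y. h x a # y) (l x) [])"
    by (intro computable_foldr computable_intros computable_fun_fst_snd assms)
  moreover have "foldr (\<lambda>a y. f a # y) xs [] = map f xs" for f :: "'a \<Rightarrow> 'b" and xs
    by (induction xs) simp_all
  ultimately show ?thesis by simp
qed

lemma computable_append:
  fixes f g :: "'x::encodable \<Rightarrow> 'a::encodable list"
  assumes "computable f" and "computable g"
  shows "computable (\<lambda>x. f x @ g x)"
proof -
  have "computable (\<lambda>x. foldr (\<lambda>a y. a # y) (f x) (g x))"
    by (intro computable_foldr computable_intros assms)
  moreover have "foldr (\<lambda>a y. a # y) xs ys = xs @ ys" for xs ys :: "'a list"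
    by (induction xs) simp_all
  ultimately show ?thesis by simp
qed

lemma computable_concat:
  fixes f :: "'x::encodable \<Rightarrow> 'a::encodable list list"
  assumes "computable f"
  shows "computable (\<lambda>x. concat (f x))"
proof -
  have "computable (\<lambda>x. foldr (\<lambda>a y. a @ y) (f x) [])"
    by (intro computable_foldr computable_append computable_intros assms)
  moreover have "foldr (\<lambda>a y. a @ y) xs [] = concat xs" for xs :: "'a list list"
    by (induction xs) simp_all
  ultimately show ?thesis by simp
qed

lemma computable_filter:
  fixes h :: "'x::encodable \<Rightarrow> 'a::encodable \<Rightarrow> bool"
  assumes "computable (\<lambda>p. h (fst p) (snd p))" and "computable l"
  shows "computable (\<lambda>x. filter (\<lambda>a. h x a) (l x))"
proof -
  have "computable (\<lambda>x. foldr (\<lambda>a y. if h x a then a # y else y) (l x) [])"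
    by (intro computable_foldr computable_intros computable_fun_fst_snd assms)
  moreover have "foldr (\<lambda>a y. if f a then a # y else y) xs [] = filter f xs" for f and xs :: "'a list"
    by (induction xs) simp_all
  ultimately show ?thesis by simp
qed

lemma computable_bex_set:
  fixes h :: "'x::encodable \<Rightarrow> 'a::encodable \<Rightarrow> bool"
  assumes "computable (\<lambda>p. h (fst p) (snd p))" and "computable l"
  shows "computable (\<lambda>x. \<exists>a\<in>set (l x). h x a)"
proof -
  have "computable (\<lambda>x. foldr (\<lambda>a y. h x a \<or> y) (l x) False)"
    by (intro computable_foldr computable_intros computable_fun_fst_snd assms)
  moreover have "foldr (\<lambda>a y. f a \<or> y) xs False \<longleftrightarrow> (\<exists>a\<in>set xs. f a)" for f and xs :: "'a list"
    by (induction xs) simp_all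
  ultimately show ?thesis by simp
qed

lemma computable_ball_set:
  assumes "computable (\<lambda>p. h (fst p) (snd p))" and "computable l"
  shows "computable (\<lambda>x. \<forall>a\<in>set (l x). h x a)"
proof -
  have "computable (\<lambda>x. \<not> (\<exists>a\<in>set (l x). \<not> h x a))"
    by (intro computable_not computable_bex_set assms)
  then show ?thesis by simp
qed

lemma computable_mem_set:
  assumes "computable f" and "computable l"
  shows "computable (\<lambda>x. f x \<in> set (l x))"
proof -
  have "computable (\<lambda>x. \<exists>a\<in>set (l x). f x = a)"
    by (intro computable_bex_set computable_eq computable_snd computable_id assms
        computable_comp[OF assms(1) computable_fst[OF computable_id]])
  then show ?thesis by simp
qed

lemma computable_subset_set:
  assumes "computable f" and "computable g"
  shows "computable (\<lambda>x. set (f x) \<subseteq> set (g x))"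
  unfolding subset_eq
  by (intro computable_ball_set computable_mem_set computable_snd computable_id assms
      computable_comp[OF assms(2) computable_fst[OF computable_id]])

lemma computable_subseqs:
  fixes f :: "'a::encodable \<Rightarrow> 'b::encodable list"
  assumes "computable f"
  shows "computable (\<lambda>x. subseqs (f x))"
proof -
  have "computable (\<lambda>x. foldr (\<lambda>a y. map (\<lambda>b. a # b) y @ y) (f x) [[]])"
    by (intro computable_foldr computable_append computable_map computable_intros assms)
  moreover have "foldr (\<lambda>a y. map (\<lambda>b. a # b) y @ y) xs [[]] = subseqs xs" for xs :: "'b list"
    by (induction xs) (simp_all add: Let_def)
  ultimately show ?thesis by simp
qed

lemma computable_funpow:
  fixes n :: "'x::encodable \<Rightarrow> nat" and z :: "'x \<Rightarrow> 'b::encodable"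
  fixes h :: "'x \<Rightarrow> 'b \<Rightarrow> 'b"
  assumes "computable (\<lambda>p. h (fst p) (snd p))" and "computable n" and "computable z"
  shows "computable (\<lambda>x. ((\<lambda>y. h x y) ^^ n x) (z x))"
proof -
  have "computable (\<lambda>x. rec_nat (z x) (\<lambda>_ y. h x y) (n x))"
    by (intro computable_rec_nat assms(2,3) computable_comp2[OF assms(1)] computable_intros)
  moreover have "rec_nat y (\<lambda>_. f) k = (f ^^ k) y" for f and y :: 'b and k
    by (induction k) simp_all
  ultimately show ?thesis by simp
qed

section \<open>Stable models of ground programs\<close>

text \<open>Stability for an arbitrary set of rules, so that it also applies to the bottom rules and
  to programs extended by facts. The bound by the base is automatic for ground programs, see
  \<open>stable_model_iff\<close>.\<close>

definition stable :: "rule set \<Rightarrow> atm set \<Rightarrow> bool" where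
  "stable G M \<longleftrightarrow> satisfies M (reduct G M) \<and> (\<forall>N. N \<subset> M \<longrightarrow> \<not> satisfies N (reduct G M))"

lemma finite_atoms [simp]: "finite (head r)" "finite (body_pos r)" "finite (body_neg r)" "finite (atoms r)"
  by (simp_all add: head_def body_pos_def body_neg_def atoms_def)

lemma satisfies_reduct_iff:
  "satisfies N (reduct G M) \<longleftrightarrow>
     (\<forall>r\<in>G. body_neg r \<inter> M = {} \<and> body_pos r \<subseteq> N \<longrightarrow> head r \<inter> N \<noteq> {})"
proof -
  have "reduct G M = (\<lambda>r. Rule (head_list r) (pos_list r) []) ` {r \<in> G. body_neg r \<inter> M = {}}"
    unfolding reduct_def by blast
  then show ?thesis
    unfolding satisfies_def by (auto simp: head_def body_pos_def body_neg_def)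
qed

lemma satisfies_reduct_self: "satisfies M (reduct G M) \<longleftrightarrow> satisfies M G"
  unfolding satisfies_reduct_iff by (simp add: satisfies_def conj_commute)

text \<open>Deleting from \<open>M\<close> all atoms that head no rule leaves a model of the reduct,
  so minimality of \<open>M\<close> forbids such atoms.\<close>

lemma stable_subset_heads:
  assumes "stable G M"
  shows "M \<subseteq> (\<Union>r\<in>G. head r)"
proof -
  let ?N = "M \<inter> (\<Union>r\<in>G. head r)"
  have "satisfies ?N (reduct G M)"
    unfolding satisfies_reduct_iff
  proof (intro ballI impI)
    fix r assume r: "r \<in> G" and "body_neg r \<inter> M = {} \<and> body_pos r \<subseteq> ?N"
    then have "head r \<inter> M \<noteq> {}" using assms unfolding stable_def satisfies_reduct_iff by simp
    then show "head r \<inter> ?N \<noteq> {}" using r by blast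
  qed
  then show ?thesis using assms unfolding stable_def by blast
qed

section \<open>Existence of stable models under a level mapping\<close>

text \<open>This is local stratification. The clause on nonempty heads excludes constraints, which
  could leave the program without any model.\<close>

definition level_mapping :: "rule set \<Rightarrow> (atm \<Rightarrow> nat) \<Rightarrow> bool" where
  "level_mapping G l \<longleftrightarrow> (\<forall>r\<in>G. head r \<noteq> {} \<and>
     (\<forall>a\<in>head r. (\<forall>b\<in>body_pos r. l b \<le> l a) \<and> (\<forall>b\<in>body_neg r. l b < l a)))"

text \<open>A rule is imposed only once its whole head lies below \<open>k\<close>. A rule with head
  atoms of several levels is thus deferred to the highest of them, where an atom of that level can
  always satisfy it.\<close>

definition partial_model :: "rule set \<Rightarrow> (atm \<Rightarrow> nat) \<Rightarrow> nat \<Rightarrow> atm set \<Rightarrow> bool" where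
  "partial_model G l k J \<longleftrightarrow>
     J \<subseteq> {a. l a < k} \<and> satisfies J {r \<in> G. head r \<subseteq> {a. l a < k}}"

lemma level_mapping_body:
  assumes "level_mapping G l" and "r \<in> G" and "head r \<subseteq> {a. l a < k}"
  shows "body_pos r \<subseteq> {a. l a < k}"
    and "k = Suc m \<Longrightarrow> body_neg r \<subseteq> {a. l a < m}"
proof -
  obtain a where a: "a \<in> head r" using assms(1,2) unfolding level_mapping_def by blast
  have l: "l a < k" "\<And>b. b \<in> body_pos r \<Longrightarrow> l b \<le> l a" "\<And>b. b \<in> body_neg r \<Longrightarrow> l b < l a"
    using assms a unfolding level_mapping_def by auto
  show "body_pos r \<subseteq> {a. l a < k}" using l(1,2) by fastforce
  show "body_neg r \<subseteq> {a. l a < m}" if "k = Suc m" using l(1,3) that by fastforce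
qed

text \<open>
  Any negative body of a rule with head in the levels up to k lies below level k, where J is
  fixed; so removing atoms of level k cannot enable new rules, and chains of candidates have
  lower bounds because heads are finite.
\<close>

lemma minimal_extension_exists:
  assumes lm: "level_mapping G l" and J: "partial_model G l k J"
  shows "\<exists>J'. partial_model G l (Suc k) J' \<and> J' \<inter> {a. l a < k} = J \<and>
    (\<forall>K. partial_model G l (Suc k) K \<and> K \<inter> {a. l a < k} = J \<and> K \<subseteq> J' \<longrightarrow> K = J')"
proof -
  define L where "L = {a. l a = k}"
  \<comment> \<open>Zorn's lemma is applied to the sets of omitted atoms of level \<open>k\<close>:
    a maximal omission is a minimal extension.\<close>
  define A where "A = {D. D \<subseteq> L \<and> partial_model G l (Suc k) (J \<union> (L - D))}"
  have J_below: "J \<subseteq> {a. l a < k}" using J by (simp add: partial_model_def)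
  have "\<exists>D\<in>A. \<forall>E\<in>A. D \<subseteq> E \<longrightarrow> E = D"
  proof (rule subset_Zorn_nonempty)
    \<comment> \<open>Omitting nothing is admissible: a rule with a head atom of level
      \<open>k\<close> holds outright, and every other one was already imposed on
      \<open>J\<close>.\<close>
    have "head r \<inter> (J \<union> L) \<noteq> {}"
      if r: "r \<in> G" "head r \<subseteq> {a. l a < Suc k}"
        and body: "body_pos r \<subseteq> J \<union> L" "body_neg r \<inter> (J \<union> L) = {}" for r
    proof (cases "head r \<subseteq> {a. l a < k}")
      case True
      have "body_pos r \<subseteq> J" using level_mapping_body(1)[OF lm r(1) True] body(1) by (auto simp: L_def)
      then show ?thesis using J True r(1) body(2) unfolding partial_model_def satisfies_def by blast
    next
      case False
      then show ?thesis using r(2) by (auto simp: L_def less_Suc_eq)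
    qed
    then have "partial_model G l (Suc k) (J \<union> (L - {}))"
      using J_below unfolding partial_model_def satisfies_def by (auto simp: L_def)
    then show "A \<noteq> {}" unfolding A_def by blast
  next
    fix C assume C: "C \<noteq> {}" "subset.chain A C"
    have CA: "C \<subseteq> A" using C(2) by (simp add: subset.chain_def)
    have "head r \<inter> (J \<union> (L - \<Union>C)) \<noteq> {}"
      if r: "r \<in> G" "head r \<subseteq> {a. l a < Suc k}"
        and body: "body_pos r \<subseteq> J \<union> (L - \<Union>C)" "body_neg r \<inter> (J \<union> (L - \<Union>C)) = {}" for r
    proof
      assume none: "head r \<inter> (J \<union> (L - \<Union>C)) = {}"
      then have "head r \<inter> L \<subseteq> \<Union>C" by blast
      then obtain D where D: "D \<in> C" "head r \<inter> L \<subseteq> D"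
        using C finite_subset_Union_chain[of "head r \<inter> L" C A] by auto
      have "body_neg r \<inter> L = {}"
        using level_mapping_body(2)[OF lm r refl] by (auto simp: L_def)
      then have "body_neg r \<inter> (J \<union> (L - D)) = {}" using body(2) by blast
      moreover have "body_pos r \<subseteq> J \<union> (L - D)" using body(1) D(1) by blast
      moreover have "partial_model G l (Suc k) (J \<union> (L - D))" using D(1) CA by (auto simp: A_def)
      ultimately have "head r \<inter> (J \<union> (L - D)) \<noteq> {}"
        using r unfolding partial_model_def satisfies_def by blast
      then show False using none D(2) by blast
    qed
    moreover have "\<Union>C \<subseteq> L" using CA by (auto simp: A_def)
    ultimately show "\<Union>C \<in> A"
      using J_below unfolding A_def partial_model_def satisfies_def by (auto simp: L_def)
  qed
  then obtain D where D: "D \<in> A" and max: "\<And>E. E \<in> A \<Longrightarrow> D \<subseteq> E \<Longrightarrow> E = D" by blast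
  have "K = J \<union> (L - D)"
    if K: "partial_model G l (Suc k) K" "K \<inter> {a. l a < k} = J" "K \<subseteq> J \<union> (L - D)" for K
  proof -
    have K_eq: "K = J \<union> (L - (L - K))" using K(2,3) by blast
    then have "L - K \<in> A" using K(1) unfolding A_def by auto
    moreover have "D \<subseteq> L - K" using D K(3) J_below by (fastforce simp: A_def L_def)
    ultimately have "L - K = D" by (rule max)
    then show ?thesis using K_eq by blast
  qed
  moreover have "partial_model G l (Suc k) (J \<union> (L - D))" using D by (simp add: A_def)
  moreover have "(J \<union> (L - D)) \<inter> {a. l a < k} = J" using J_below by (auto simp: L_def)
  ultimately show ?thesis by blast
qed

text \<open>Dependent choice yields a tower of partial models, each minimal over its predecessor,
  and the union is the model. If a smaller \<open>N\<close> satisfied the reduct, it would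
  contradict minimality at the lowest level where it loses an atom: below that level
  \<open>N\<close> and \<open>M\<close> agree, and the negative bodies that matter lie
  there.\<close>

lemma stable_model_exists:
  assumes lm: "level_mapping G l"
  shows "\<exists>M. stable G M"
proof -
  define Q where "Q k J J' \<longleftrightarrow> J' \<inter> {a. l a < k} = J \<and>
    (\<forall>K. partial_model G l (Suc k) K \<and> K \<inter> {a. l a < k} = J \<and> K \<subseteq> J' \<longrightarrow> K = J')" for k J J'
  have "\<exists>f. \<forall>k. partial_model G l k (f k) \<and> Q k (f k) (f (Suc k))"
  proof (rule dependent_nat_choice)
    have "{r \<in> G. head r \<subseteq> {a. l a < 0}} = {}" using lm by (auto simp: level_mapping_def)
    then have "partial_model G l 0 {}" unfolding partial_model_def satisfies_def by blast
    then show "\<exists>J. partial_model G l 0 J" ..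
    show "\<exists>J'. partial_model G l (Suc k) J' \<and> Q k J J'" if "partial_model G l k J" for J k
      using minimal_extension_exists[OF lm that] unfolding Q_def .
  qed
  then obtain f where f: "\<And>k. partial_model G l k (f k)" "\<And>k. Q k (f k) (f (Suc k))" by blast
  define M where "M = (\<Union>k. f k)"
  have below: "f k \<subseteq> {a. l a < k}" for k using f(1)[of k] by (simp add: partial_model_def)
  have restrict: "f m \<inter> {a. l a < k} = f k" if "k \<le> m" for k m
    using that
  proof (induction m rule: dec_induct)
    case base
    then show ?case using below by blast
  next
    case (step m)
    have "f (Suc m) \<inter> {a. l a < m} = f m" using f(2)[of m] by (simp add: Q_def)
    moreover have "{a. l a < m} \<inter> {a. l a < k} = {a. l a < k}" using step(1) by auto
    ultimately show ?case using step(3) by (metis inf_assoc)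
  qed
  have M_restrict: "M \<inter> {a. l a < k} = f k" for k
  proof -
    have "f m \<inter> {a. l a < k} \<subseteq> f k" for m
    proof (cases "k \<le> m")
      case True
      then show ?thesis by (simp only: restrict[OF True] subset_refl)
    next
      case False
      then show ?thesis using equalityD2[OF restrict[of m k]] by (simp add: le_infI1)
    qed
    then show ?thesis using below[of k] by (auto simp only: M_def)
  qed
  have "satisfies M G"
    unfolding satisfies_def
  proof (intro ballI impI)
    fix r assume r: "r \<in> G" and body: "body_pos r \<subseteq> M \<and> body_neg r \<inter> M = {}"
    \<comment> \<open>Heads are finite, so every rule is imposed from some stage on.\<close>
    define k where "k = Suc (Max (l ` head r))"
    have head: "head r \<subseteq> {a. l a < k}" by (auto simp: k_def less_Suc_eq_le)
    have "body_pos r \<subseteq> f k" using level_mapping_body(1)[OF lm r head] body M_restrict[of k] by blast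
    moreover have "body_neg r \<inter> f k = {}" using body M_restrict[of k] by blast
    ultimately have "head r \<inter> f k \<noteq> {}"
      using f(1)[of k] r head unfolding partial_model_def satisfies_def by blast
    then show "head r \<inter> M \<noteq> {}" by (auto simp: M_def)
  qed
  moreover have "\<not> satisfies N (reduct G M)" if "N \<subset> M" for N
  proof
    assume N: "satisfies N (reduct G M)"
    define k where "k = (LEAST k. \<exists>a\<in>M - N. l a = k)"
    have "\<exists>k. \<exists>a\<in>M - N. l a = k" using that by blast
    then have "\<exists>a\<in>M - N. l a = k" unfolding k_def by (rule LeastI_ex)
    then obtain a where a: "a \<in> M - N" "l a = k" by blast
    have agree: "b \<in> N" if "b \<in> M" "l b < k" for b
    proof (rule ccontr)
      assume "b \<notin> N"
      then have "\<exists>a\<in>M - N. l a = l b" using that(1) by blast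
      then have "k \<le> l b" unfolding k_def by (rule Least_le)
      then show False using that(2) by simp
    qed
    define K where "K = N \<inter> {a. l a < Suc k}"
    have "head r \<inter> K \<noteq> {}"
      if r: "r \<in> G" "head r \<subseteq> {a. l a < Suc k}"
        and body: "body_pos r \<subseteq> K" "body_neg r \<inter> K = {}" for r
    proof -
      \<comment> \<open>The negative body lies below level \<open>k\<close>, where every atom of
        \<open>M\<close> belongs to \<open>N\<close>.\<close>
      have "body_neg r \<inter> M = {}"
        using level_mapping_body(2)[OF lm r refl] body(2) agree by (fastforce simp: K_def)
      then have "head r \<inter> N \<noteq> {}"
        using N r(1) body(1) unfolding satisfies_reduct_iff K_def by blast
      then show ?thesis using r(2) by (auto simp: K_def)
    qed
    then have "partial_model G l (Suc k) K"
      unfolding partial_model_def satisfies_def by (auto simp: K_def)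
    moreover have "K \<inter> {a. l a < k} = f k"
      using agree \<open>N \<subset> M\<close> unfolding M_restrict[symmetric] by (auto simp: K_def)
    moreover have "K \<subseteq> f (Suc k)" using \<open>N \<subset> M\<close> unfolding M_restrict[symmetric] by (auto simp: K_def)
    ultimately have "K = f (Suc k)" using f(2)[of k] unfolding Q_def by blast
    then have "a \<in> K" using a unfolding M_restrict[symmetric] by simp
    then show False using a by (simp add: K_def)
  qed
  ultimately show ?thesis unfolding stable_def satisfies_reduct_self by blast
qed

section \<open>Splitting sets: restriction and extension of stable models\<close>

definition splitting :: "rule set \<Rightarrow> atm set \<Rightarrow> bool" where
  "splitting G R \<longleftrightarrow> (\<forall>r\<in>G. head r \<inter> R \<noteq> {} \<longrightarrow> atoms r \<subseteq> R)"

definition bottom :: "rule set \<Rightarrow> atm set \<Rightarrow> rule set" where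
  "bottom G R = {r \<in> G. head r \<inter> R \<noteq> {}}"

lemma bottom_atoms:
  assumes "splitting G R" and "r \<in> bottom G R"
  shows "head r \<subseteq> R" "body_pos r \<subseteq> R" "body_neg r \<subseteq> R" "r \<in> G"
  using assms unfolding splitting_def bottom_def atoms_def by blast+

text \<open>A smaller model \<open>N\<close> of the bottom reduct would give the smaller model
  \<open>N \<union> (M - R)\<close> of the whole reduct: rules outside the bottom have no head atom
  in \<open>R\<close>, so their head atoms in \<open>M\<close> survive.\<close>

lemma stable_restrict:
  assumes sp: "splitting G R" and M: "stable G M"
  shows "stable (bottom G R) (M \<inter> R)"
proof -
  note b = bottom_atoms[OF sp]
  have sat: "satisfies M G" using M unfolding stable_def satisfies_reduct_self by blast
  have "satisfies (M \<inter> R) (bottom G R)"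
    unfolding satisfies_def
  proof (intro ballI impI)
    fix r assume r: "r \<in> bottom G R" and "body_pos r \<subseteq> M \<inter> R \<and> body_neg r \<inter> (M \<inter> R) = {}"
    then have "head r \<inter> M \<noteq> {}" using sat b[OF r] unfolding satisfies_def by blast
    then show "head r \<inter> (M \<inter> R) \<noteq> {}" using b(1)[OF r] by blast
  qed
  moreover have "\<not> satisfies N (reduct (bottom G R) (M \<inter> R))" if N: "N \<subset> M \<inter> R" for N
  proof
    assume sN: "satisfies N (reduct (bottom G R) (M \<inter> R))"
    have "satisfies (N \<union> (M - R)) (reduct G M)"
      unfolding satisfies_reduct_iff
    proof (intro ballI impI)
      fix r assume r: "r \<in> G" and body: "body_neg r \<inter> M = {} \<and> body_pos r \<subseteq> N \<union> (M - R)"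
      show "head r \<inter> (N \<union> (M - R)) \<noteq> {}"
      proof (cases "r \<in> bottom G R")
        case True
        have "body_pos r \<subseteq> N" using b(2)[OF True] body by blast
        then have "head r \<inter> N \<noteq> {}" using sN True body unfolding satisfies_reduct_iff by blast
        then show ?thesis by blast
      next
        case False
        have "head r \<inter> M \<noteq> {}" using sat r body N unfolding satisfies_def by blast
        then show ?thesis using False r by (auto simp: bottom_def)
      qed
    qed
    moreover have "N \<union> (M - R) \<subset> M" using N by blast
    ultimately show False using M unfolding stable_def by blast
  qed
  ultimately show ?thesis unfolding stable_def satisfies_reduct_self by blast
qed

text \<open>
  Replacing the bottom rules by the atoms of a stable model of them, as facts, leaves a program
  with the same level mapping.
\<close>

lemma stable_extend:
  assumes sp: "splitting G R" and lm: "level_mapping G l" and B: "stable (bottom G R) B"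
  shows "\<exists>M. stable G M \<and> M \<inter> R = B"
proof -
  note b = bottom_atoms[OF sp]
  let ?H = "(G - bottom G R) \<union> (\<lambda>a. Rule [a] [] []) ` B"
  have "level_mapping ?H l"
    using lm by (auto simp: level_mapping_def head_def body_pos_def body_neg_def)
  then obtain M where M: "stable ?H M" using stable_model_exists by blast
  then have sat: "satisfies M ?H" unfolding stable_def satisfies_reduct_self by blast
  have "B \<subseteq> M" using sat unfolding satisfies_def
    by (auto simp: head_def body_pos_def body_neg_def ball_Un)
  have "B \<subseteq> (\<Union>r\<in>bottom G R. head r)" using B by (rule stable_subset_heads)
  then have "B \<subseteq> R" using b(1) by blast
  \<comment> \<open>Of the rules in \<open>?H\<close>, only the facts have head atoms in
    \<open>R\<close>.\<close>
  have "M \<subseteq> (\<Union>r\<in>?H. head r)" using M by (rule stable_subset_heads)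
  then have "M \<inter> R \<subseteq> B" by (auto simp: bottom_def head_def)
  then have MR: "M \<inter> R = B" using \<open>B \<subseteq> M\<close> \<open>B \<subseteq> R\<close> by blast
  have satB: "satisfies B (bottom G R)" using B unfolding stable_def satisfies_reduct_self by blast
  have "satisfies M G"
    unfolding satisfies_def
  proof (intro ballI impI)
    fix r assume r: "r \<in> G" and body: "body_pos r \<subseteq> M \<and> body_neg r \<inter> M = {}"
    show "head r \<inter> M \<noteq> {}"
    proof (cases "r \<in> bottom G R")
      case True
      have "body_pos r \<subseteq> B" "body_neg r \<inter> B = {}" using body b(2)[OF True] MR by blast+
      then show ?thesis using satB True MR unfolding satisfies_def by blast
    next
      case False
      then show ?thesis using sat r body unfolding satisfies_def by blast
    qed
  qed
  moreover have "\<not> satisfies N (reduct G M)" if N: "N \<subset> M" for N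
  proof
    assume sN: "satisfies N (reduct G M)"
    have "satisfies (N \<inter> R) (reduct (bottom G R) B)"
      unfolding satisfies_reduct_iff
    proof (intro ballI impI)
      fix r assume r: "r \<in> bottom G R" and body: "body_neg r \<inter> B = {} \<and> body_pos r \<subseteq> N \<inter> R"
      have "body_neg r \<inter> M = {}" using body b(3)[OF r] MR by blast
      then have "head r \<inter> N \<noteq> {}" using sN b(4)[OF r] body unfolding satisfies_reduct_iff by blast
      then show "head r \<inter> (N \<inter> R) \<noteq> {}" using b(1)[OF r] by blast
    qed
    moreover have "N \<inter> R \<subseteq> B" using N MR by blast
    \<comment> \<open>Minimality of \<open>B\<close> forces \<open>N\<close> to contain all the
      facts, so that \<open>N\<close> competes with \<open>M\<close> as a model for
      \<open>?H\<close>.\<close>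
    ultimately have "N \<inter> R = B" using B unfolding stable_def by blast
    then have "satisfies N (reduct ?H M)"
      using sN unfolding satisfies_reduct_iff
      by (auto simp: ball_Un head_def body_pos_def body_neg_def)
    then show False using M N unfolding stable_def by blast
  qed
  ultimately show ?thesis using MR unfolding stable_def satisfies_reduct_self by blast
qed

section \<open>Stratification and relevance\<close>

lemma pred_subst_atm [simp]: "pred_atm (subst_atm \<sigma> a) = pred_atm a"
  by (cases a) simp

lemma subst_rule_sets:
  "head (subst_rule \<sigma> r) = subst_atm \<sigma> ` head r"
  "body_pos (subst_rule \<sigma> r) = subst_atm \<sigma> ` body_pos r"
  "body_neg (subst_rule \<sigma> r) = subst_atm \<sigma> ` body_neg r"
  "atoms (subst_rule \<sigma> r) = subst_atm \<sigma> ` atoms r"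
  by (cases r; force simp: head_def body_pos_def body_neg_def atoms_def)+

text \<open>The level of a predicate is the number of predicates that some dependency path from it
  enters by a negative step. Along a dependency this set can only shrink. A negative dependency of
  \<open>p\<close> on \<open>q\<close> shrinks it properly: \<open>q\<close> is in the set of
  \<open>p\<close>, but not in its own, since that would close a cycle through a negative
  dependency.\<close>

lemma asp_fs_level_mapping:
  assumes "asp_fs P"
  shows "\<exists>l. level_mapping (Ground P) l"
proof -
  let ?dep = "pos_dep P \<union> neg_dep P"
  define S where "S p = {q. \<exists>p'. (p, p') \<in> ?dep\<^sup>* \<and> (p', q) \<in> neg_dep P}" for p
  have "neg_dep P \<subseteq> (\<Union>r\<in>P. \<Union>a\<in>head r. \<Union>b\<in>body_neg r. {(pred_atm a, pred_atm b)})"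
    unfolding neg_dep_def by blast
  moreover have "finite \<dots>" using assms by (auto simp: asp_fs_def)
  ultimately have "finite (neg_dep P)" by (rule finite_subset)
  then have fin: "finite (S p)" for p
    by (rule finite_subset[rotated, OF finite_imageI[of _ snd]]) (force simp: S_def)
  have pos: "S q \<subseteq> S p" if "(p, q) \<in> ?dep" for p q
    using that unfolding S_def by (blast intro: converse_rtrancl_into_rtrancl)
  have neg: "S q \<subset> S p" if "(p, q) \<in> neg_dep P" for p q
  proof -
    have "q \<in> S p" using that unfolding S_def by blast
    moreover have "q \<notin> S q" using assms unfolding S_def asp_fs_def stratified_def by blast
    ultimately show ?thesis using pos[of p q] that by blast
  qed
  have "level_mapping (Ground P) (\<lambda>a. card (S (pred_atm a)))"
    unfolding level_mapping_def
  proof (intro ballI conjI)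
    fix r assume "r \<in> Ground P"
    then obtain \<sigma> s where r: "r = subst_rule \<sigma> s" and s: "s \<in> P" by (auto simp: Ground_def)
    show "head r \<noteq> {}" using assms s by (auto simp: r subst_rule_sets asp_fs_def)
    fix a b assume "a \<in> head r"
    then obtain a' where a': "pred_atm a = pred_atm a'" "a' \<in> head s"
      by (auto simp: r subst_rule_sets)
    show "card (S (pred_atm b)) \<le> card (S (pred_atm a))" if b: "b \<in> body_pos r"
    proof -
      obtain b' where "b = subst_atm \<sigma> b'" "b' \<in> body_pos s"
        using b by (auto simp: r subst_rule_sets)
      then have "pred_atm b = pred_atm b'" "b' \<in> body_pos s" by simp_all
      then have "(pred_atm a, pred_atm b) \<in> pos_dep P"
        using a' s unfolding pos_dep_def by blast
      then show ?thesis using fin pos by (intro card_mono) auto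
    qed
    show "card (S (pred_atm b)) < card (S (pred_atm a))" if b: "b \<in> body_neg r"
    proof -
      obtain b' where "b = subst_atm \<sigma> b'" "b' \<in> body_neg s"
        using b by (auto simp: r subst_rule_sets)
      then have "pred_atm b = pred_atm b'" "b' \<in> body_neg s" by simp_all
      then have "(pred_atm a, pred_atm b) \<in> neg_dep P"
        using a' s unfolding neg_dep_def by blast
      then show ?thesis using fin neg by (intro psubset_card_mono) auto
    qed
  qed
  then show ?thesis by blast
qed

lemma vars_subst_trm: "vars_trm (subst_trm \<sigma> t) = (\<Union>x\<in>vars_trm t. vars_trm (\<sigma> x))"
  by (induction t) auto

lemma funs_subst_trm: "funs_trm (subst_trm \<sigma> t) = funs_trm t \<union> (\<Union>x\<in>vars_trm t. funs_trm (\<sigma> x))"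
  by (induction t) auto

lemma vars_subst_atm: "vars_atm (subst_atm \<sigma> a) = (\<Union>x\<in>vars_atm a. vars_trm (\<sigma> x))"
  by (cases a) (auto simp: vars_subst_trm)

lemma funs_subst_atm: "funs_atm (subst_atm \<sigma> a) = funs_atm a \<union> (\<Union>x\<in>vars_atm a. funs_trm (\<sigma> x))"
  by (cases a) (auto simp: funs_subst_trm)

lemma Ground_query:
  assumes "r \<in> Ground P" and "a \<in> atoms r"
  shows "query P a"
proof -
  from assms(1) obtain \<sigma> s where r: "r = subst_rule \<sigma> s" "s \<in> P" "\<sigma> ` vars_rule s \<subseteq> universe P"
    by (auto simp: Ground_def)
  from assms(2) obtain a' where a': "a = subst_atm \<sigma> a'" "a' \<in> atoms s"
    by (auto simp: r subst_rule_sets)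
  have "\<sigma> ` vars_atm a' \<subseteq> universe P" using r(3) a'(2) unfolding vars_rule_def by blast
  moreover have "funs_atm a' \<subseteq> funs_program P" using r(2) a'(2) unfolding funs_program_def by blast
  ultimately show ?thesis
    unfolding query_def a'(1) vars_subst_atm funs_subst_atm universe_def by blast
qed

lemma Ground_head_subset_base: "(\<Union>r\<in>Ground P. head r) \<subseteq> base P"
proof
  fix a assume "a \<in> (\<Union>r\<in>Ground P. head r)"
  then obtain r where r: "r \<in> Ground P" "a \<in> head r" by blast
  have "query P a" using r by (intro Ground_query) (auto simp: atoms_def)
  moreover have "pred_atm a \<in> preds_program P"
    using r by (fastforce simp: Ground_def subst_rule_sets preds_program_def atoms_def)
  ultimately show "a \<in> base P"
    by (cases a) (auto simp: query_def base_def universe_def)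
qed

lemma stable_model_iff: "stable_model P M \<longleftrightarrow> stable (Ground P) M"
  using stable_subset_heads[of "Ground P" M] Ground_head_subset_base
  unfolding stable_model_def stable_def by blast

lemma splitting_relevant: "splitting (Ground P) (relevant P Q)"
  unfolding splitting_def by (blast intro: relevant.step)

text \<open>Membership of \<open>Q\<close> survives restriction and extension because
  \<open>Q \<in> R\<close>. The bound \<open>Pow R\<close> loses nothing, as stable models of the
  bottom rules consist of head atoms, and makes the quantification finite for finite
  \<open>R\<close>.\<close>

lemma entails_iff_bottom:
  fixes Q :: atm
  assumes "asp_fs P"
  defines "R \<equiv> relevant P Q"
  shows "cautiously_entails P Q \<longleftrightarrow> (\<forall>M\<in>Pow R. stable (bottom (Ground P) R) M \<longrightarrow> Q \<in> M)"
    and "bravely_entails P Q \<longleftrightarrow> (\<exists>M\<in>Pow R. stable (bottom (Ground P) R) M \<and> Q \<in> M)"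
proof -
  obtain l where lm: "level_mapping (Ground P) l" using asp_fs_level_mapping[OF assms(1)] ..
  have sp: "splitting (Ground P) R" unfolding R_def by (rule splitting_relevant)
  have Q: "Q \<in> R" unfolding R_def by (rule relevant.self)
  have 1: "stable (bottom (Ground P) R) (M \<inter> R) \<and> (Q \<in> M \<inter> R \<longleftrightarrow> Q \<in> M)" if "stable_model P M" for M
    using stable_restrict[OF sp] that Q by (simp add: stable_model_iff)
  have 2: "\<exists>M. stable_model P M \<and> (Q \<in> M \<longleftrightarrow> Q \<in> B)" if "stable (bottom (Ground P) R) B" for B
    using stable_extend[OF sp lm that] Q unfolding stable_model_iff by blast
  show "cautiously_entails P Q \<longleftrightarrow> (\<forall>M\<in>Pow R. stable (bottom (Ground P) R) M \<longrightarrow> Q \<in> M)"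
  proof
    assume c: "cautiously_entails P Q"
    show "\<forall>M\<in>Pow R. stable (bottom (Ground P) R) M \<longrightarrow> Q \<in> M"
    proof (intro ballI impI)
      fix B assume "stable (bottom (Ground P) R) B"
      then obtain M where "stable_model P M" "Q \<in> M \<longleftrightarrow> Q \<in> B" using 2 by blast
      then show "Q \<in> B" using c by (simp add: cautiously_entails_def)
    qed
  next
    assume "\<forall>M\<in>Pow R. stable (bottom (Ground P) R) M \<longrightarrow> Q \<in> M"
    then have "Q \<in> M \<inter> R" if "stable_model P M" for M using 1[OF that] by blast
    then show "cautiously_entails P Q" by (simp add: cautiously_entails_def)
  qed
  show "bravely_entails P Q \<longleftrightarrow> (\<exists>M\<in>Pow R. stable (bottom (Ground P) R) M \<and> Q \<in> M)"
  proof
    assume "bravely_entails P Q"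
    then obtain M where "stable_model P M" "Q \<in> M" by (auto simp: bravely_entails_def)
    then show "\<exists>M\<in>Pow R. stable (bottom (Ground P) R) M \<and> Q \<in> M"
      using 1[of M] by (intro bexI[of _ "M \<inter> R"]) auto
  next
    assume "\<exists>M\<in>Pow R. stable (bottom (Ground P) R) M \<and> Q \<in> M"
    then show "bravely_entails P Q" using 2 by (auto simp: bravely_entails_def)
  qed
qed

section \<open>Terms and substitutions\<close>

lemma subst_trm_eq_iff: "subst_trm \<sigma> t = subst_trm \<tau> t \<longleftrightarrow> (\<forall>x\<in>vars_trm t. \<sigma> x = \<tau> x)"
  by (induction t) auto

lemma subst_atm_eq_iff: "subst_atm \<sigma> a = subst_atm \<tau> a \<longleftrightarrow> (\<forall>x\<in>vars_atm a. \<sigma> x = \<tau> x)"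
  by (cases a) (auto simp: subst_trm_eq_iff)

lemma subst_rule_cong:
  assumes "\<And>x. x \<in> vars_rule r \<Longrightarrow> \<sigma> x = \<tau> x"
  shows "subst_rule \<sigma> r = subst_rule \<tau> r"
  using assms
  by (cases r) (auto simp: vars_rule_def atoms_def head_def body_pos_def body_neg_def subst_atm_eq_iff)

fun atm_pred :: "atm \<Rightarrow> nat" where "atm_pred (Atom p ts) = p"

fun atm_args :: "atm \<Rightarrow> trm list" where "atm_args (Atom p ts) = ts"

fun args :: "trm \<Rightarrow> trm list" where
  "args (Var x) = []"
| "args (Fun f ts) = ts"

text \<open>The values 0 below are junk.\<close>

fun var_name :: "trm \<Rightarrow> nat" where
  "var_name (Var x) = x"
| "var_name (Fun f ts) = 0"

fun fun_name :: "trm \<Rightarrow> nat" where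
  "fun_name (Var x) = 0"
| "fun_name (Fun f ts) = f"

fun subterms :: "trm \<Rightarrow> trm set" where
  "subterms (Var x) = {Var x}"
| "subterms (Fun f ts) = insert (Fun f ts) (\<Union>t\<in>set ts. subterms t)"

lemma subterms_refl: "t \<in> subterms t"
  by (cases t) auto

lemma subst_in_subterms: "x \<in> vars_trm t \<Longrightarrow> \<sigma> x \<in> subterms (subst_trm \<sigma> t)"
  by (induction t) (auto simp: subterms_refl)

lemma Var_in_subterms: "Var x \<in> subterms t \<longleftrightarrow> x \<in> vars_trm t"
  by (induction t) auto

lemma Fun_in_subterms: "(f, n) \<in> funs_trm t \<longleftrightarrow> (\<exists>ts. Fun f ts \<in> subterms t \<and> length ts = n)"
  by (induction t) auto

lemma args_in_subterms: "u \<in> subterms t \<Longrightarrow> s \<in> set (args u) \<Longrightarrow> s \<in> subterms t"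
  by (induction t) (force intro: subterms_refl)+

lemma subterms_subset_if_args:
  assumes "t \<in> S" and "\<And>s. s \<in> set (args t) \<Longrightarrow> subterms s \<subseteq> S"
  shows "subterms t \<subseteq> S"
  using assms by (cases t) auto

lemma universe_subterms:
  assumes "t \<in> universe P" and "s \<in> subterms t"
  shows "s \<in> universe P"
proof -
  have "vars_trm s \<subseteq> vars_trm t" "funs_trm s \<subseteq> funs_trm t"
    using assms(2) by (induction t; auto; blast)+
  then show ?thesis using assms(1) by (auto simp: universe_def)
qed

text \<open>A function symbol of positive arity, applied to copies of a ground term of maximal size,
  would give a larger ground term.\<close>

lemma finite_universe_constants:
  assumes fin: "finite (universe P)" and t: "t \<in> universe P"
  shows "\<exists>f. t = Fun f [] \<and> (f, 0) \<in> funs_program P"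
proof (cases t)
  case (Var x)
  then show ?thesis using t by (simp add: universe_def)
next
  case (Fun f ts)
  have "ts = []"
  proof (rule ccontr)
    assume "ts \<noteq> []"
    have fin': "finite (size ` universe P)" using fin by simp
    then have "Max (size ` universe P) \<in> size ` universe P" using t by (intro Max_in) auto
    then obtain s where s: "s \<in> universe P" "size s = Max (size ` universe P)" by auto
    let ?u = "Fun f (replicate (length ts) s)"
    have "?u \<in> universe P" using s(1) t Fun by (auto simp: universe_def)
    then have "size ?u \<le> size s" unfolding s(2) by (intro Max_ge fin' imageI)
    moreover have "size s < size ?u" using \<open>ts \<noteq> []\<close> by (cases ts) auto
    ultimately show False by simp
  qed
  then show ?thesis using Fun t by (auto simp: universe_def)
qed

text \<open>
  A variable outside the matched head atom could be instantiated by every ground term, which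
  would make infinitely many atoms relevant unless the universe consists of constants.
\<close>

lemma matching_substitution_range:
  assumes fin: "finite (relevant P Q)" and r: "r \<in> P" and \<sigma>: "\<sigma> ` vars_rule r \<subseteq> universe P"
    and h: "h \<in> head r" "subst_atm \<sigma> h \<in> relevant P Q" and x: "x \<in> vars_rule r"
  shows "(\<exists>t\<in>set (atm_args (subst_atm \<sigma> h)). \<sigma> x \<in> subterms t) \<or>
    (\<exists>f. \<sigma> x = Fun f [] \<and> (f, 0) \<in> funs_program P)"
proof (cases "x \<in> vars_atm h")
  case True
  then show ?thesis by (cases h) (auto intro: subst_in_subterms)
next
  case False
  obtain b where b: "b \<in> atoms r" "x \<in> vars_atm b" using x by (auto simp: vars_rule_def)
  \<comment> \<open>\<open>x\<close> occurs in \<open>b\<close>, so distinct values of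
    \<open>x\<close> give distinct instances of \<open>b\<close>, while the instance of
    \<open>h\<close> does not change.\<close>
  let ?g = "\<lambda>t. subst_atm (\<sigma>(x := t)) b"
  have "inj_on ?g (universe P)"
    using b(2) by (intro inj_onI) (auto simp: subst_atm_eq_iff)
  moreover have "?g ` universe P \<subseteq> relevant P Q"
  proof
    fix c assume "c \<in> ?g ` universe P"
    then obtain t where t: "t \<in> universe P" "c = ?g t" by blast
    have "subst_rule (\<sigma>(x := t)) r \<in> Ground P"
      using r \<sigma> t(1) by (force simp: Ground_def)
    moreover have "subst_atm (\<sigma>(x := t)) h = subst_atm \<sigma> h"
      using False by (auto simp: subst_atm_eq_iff)
    then have "subst_atm \<sigma> h \<in> head (subst_rule (\<sigma>(x := t)) r)"
      using h(1) by (auto simp: subst_rule_sets intro: rev_image_eqI)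
    moreover have "c \<in> atoms (subst_rule (\<sigma>(x := t)) r)"
      using b(1) t(2) by (auto simp: subst_rule_sets)
    ultimately show "c \<in> relevant P Q" using h(2) by (blast intro: relevant.step)
  qed
  ultimately have "finite (universe P)" using fin by (meson finite_subset inj_on_finite)
  then show ?thesis using finite_universe_constants \<sigma> x by blast
qed

lemma relevant_query: "a \<in> relevant P Q \<Longrightarrow> query P Q \<Longrightarrow> query P a"
  by (induction rule: relevant.induct) (auto intro: Ground_query)

lemma query_args: "query P a \<Longrightarrow> t \<in> set (atm_args a) \<Longrightarrow> t \<in> universe P"
  by (cases a) (auto simp: query_def universe_def)

section \<open>The algorithm on lists\<close>

text \<open>The number of rounds is a crude bound on the depth: codes drop strictly from a term to
  its arguments, and \<open>enc ts\<close> bounds the codes of the entries.\<close>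

definition subterm_list :: "trm list \<Rightarrow> trm list" where
  "subterm_list ts = ((\<lambda>us. us @ concat (map args us)) ^^ enc ts) ts"

text \<open>The tag 1 of functional terms makes the inequality strict; pairing with 0 need not
  increase a number, as \<open>prod_encode (0, 0) = 0\<close> shows.\<close>

lemma enc_arg_less: "s \<in> set (args t) \<Longrightarrow> enc s < enc t"
proof (cases t)
  case (Fun f ts)
  assume "s \<in> set (args t)"
  then have "enc s \<le> enc ts" using Fun by (simp add: enc_le_enc_list)
  also have "\<dots> \<le> prod_encode (f, enc ts)" by (rule le_prod_encode_2)
  also have "\<dots> < prod_encode (1, prod_encode (f, enc ts))" by (simp add: prod_encode_def)
  finally show ?thesis by (simp add: Fun enc_Fun)
qed simp

lemma set_subterm_list: "set (subterm_list ts) = (\<Union>t\<in>set ts. subterms t)"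
proof
  let ?f = "\<lambda>us. us @ concat (map args us)"
  have "set ((?f ^^ k) ts) \<subseteq> (\<Union>t\<in>set ts. subterms t)" for k
  proof (induction k)
    case 0
    then show ?case using subterms_refl by auto
  next
    case (Suc k)
    then show ?case by (fastforce intro: args_in_subterms)
  qed
  then show "set (subterm_list ts) \<subseteq> (\<Union>t\<in>set ts. subterms t)"
    unfolding subterm_list_def .
  \<comment> \<open>Generalised over the start list, because taking off the innermost round replaces
    \<open>us\<close> by \<open>?f us\<close>.\<close>
  have "subterms t \<subseteq> set ((?f ^^ k) us)" if "t \<in> set us" "enc t \<le> k" for t k us
    using that
  proof (induction k arbitrary: t us)
    case 0
    then have "args t = []" using enc_arg_less by (metis last_in_set less_le_trans not_less_zero)
    then show ?case using 0 by (cases t) auto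
  next
    case (Suc k)
    have sub: "s \<in> set (args t) \<Longrightarrow> subterms s \<subseteq> set ((?f ^^ k) (?f us))" for s
      using Suc.prems enc_arg_less[of s t] by (intro Suc.IH) auto
    have mono: "set vs \<subseteq> set ((?f ^^ n) vs)" for vs n
      by (induction n) auto
    have "t \<in> set ((?f ^^ k) (?f us))" using mono[of "?f us" k] Suc.prems(1) by auto
    then have "subterms t \<subseteq> set ((?f ^^ k) (?f us))" using sub by (rule subterms_subset_if_args)
    then show ?case by (simp only: funpow_Suc_right o_apply)
  qed
  then show "(\<Union>t\<in>set ts. subterms t) \<subseteq> set (subterm_list ts)"
    unfolding subterm_list_def using enc_le_enc_list by blast
qed

section \<open>Substitution by means of tables\<close>

text \<open>This is \<open>map_of\<close> with a default value, written as a fold so that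
  \<open>computable_foldr\<close> applies.\<close>

definition lookup :: "('a \<times> 'b) list \<Rightarrow> 'b \<Rightarrow> 'a \<Rightarrow> 'b" where
  "lookup al d k = foldr (\<lambda>p y. if fst p = k then snd p else y) al d"

lemma lookup_map_Pair: "lookup (map (\<lambda>s. (s, g s)) xs) d k = (if k \<in> set xs then g k else d)"
  by (induction xs) (auto simp: lookup_def)

lemma lookup_mem: "k \<in> fst ` set al \<Longrightarrow> lookup al d k \<in> snd ` set al"
  by (induction al) (auto simp: lookup_def)

definition list_subst :: "(nat \<times> trm) list \<Rightarrow> nat \<Rightarrow> trm" where
  "list_subst \<sigma> x = lookup \<sigma> (Var x) x"

text \<open>
  Bottom-up evaluation: after k rounds the table is correct for the subterms with code below k.
\<close>

definition subst_round :: "(nat \<times> trm) list \<Rightarrow> trm list \<Rightarrow> (trm \<times> trm) list \<Rightarrow> (trm \<times> trm) list" where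
  "subst_round \<sigma> us tab = map (\<lambda>s. (s,
     if s = Var (var_name s) then lookup \<sigma> s (var_name s)
     else Fun (fun_name s) (map (\<lambda>u. lookup tab u u) (args s)))) us"

lemma lookup_subst_round:
  "s \<in> set us \<Longrightarrow> lookup (subst_round \<sigma> us tab) d s =
     (if s = Var (var_name s) then lookup \<sigma> s (var_name s)
      else Fun (fun_name s) (map (\<lambda>u. lookup tab u u) (args s)))"
  unfolding subst_round_def lookup_map_Pair by simp

lemma subst_trm_eq_lookup:
  "subst_trm (list_subst \<sigma>) t =
     lookup ((subst_round \<sigma> (subterm_list [t]) ^^ Suc (enc t)) []) t t"
proof -
  let ?us = "subterm_list [t]"
  let ?tab = "\<lambda>k. (subst_round \<sigma> ?us ^^ k) []"
  \<comment> \<open>Arguments need rows of their own in the table, since a missing row would return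
    the argument unsubstituted.\<close>
  have closed: "u \<in> set ?us" if "s \<in> set ?us" "u \<in> set (args s)" for s u
    using that by (auto simp: set_subterm_list intro: args_in_subterms)
  have "lookup (?tab k) s s = subst_trm (list_subst \<sigma>) s" if "s \<in> set ?us" "enc s < k" for k s
    using that
  proof (induction k arbitrary: s)
    case (Suc k)
    show ?case
    proof (cases s)
      case (Var x)
      then show ?thesis using Suc.prems
        by (simp add: lookup_subst_round list_subst_def)
    next
      case (Fun f ts)
      have "lookup (?tab k) u u = subst_trm (list_subst \<sigma>) u" if "u \<in> set ts" for u
      proof (rule Suc.IH)
        show "u \<in> set ?us" using closed[OF Suc.prems(1)] that Fun by simp
        show "enc u < k" using enc_arg_less[of u s] that Fun Suc.prems(2) by simp
      qed
      then show ?thesis using Suc.prems Fun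
        by (simp add: lookup_subst_round)
    qed
  qed simp
  then show ?thesis by (simp add: set_subterm_list subterms_refl del: funpow.simps)
qed

section \<open>Enumeration of rule instances\<close>

definition assignments :: "nat list \<Rightarrow> trm list \<Rightarrow> (nat \<times> trm) list list" where
  "assignments xs ts =
     foldr (\<lambda>x \<sigma>s. concat (map (\<lambda>t. map (\<lambda>\<sigma>. (x, t) # \<sigma>) \<sigma>s) ts)) xs [[]]"

lemma set_assignments:
  "set (assignments xs ts) = {\<sigma>. map fst \<sigma> = xs \<and> snd ` set \<sigma> \<subseteq> set ts}"
proof (induction xs)
  case (Cons x xs)
  have "set (assignments (x # xs) ts) = {(x, t) # \<sigma> | t \<sigma>. t \<in> set ts \<and> \<sigma> \<in> set (assignments xs ts)}"
    by (auto simp: assignments_def)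
  also have "\<dots> = {\<sigma>. map fst \<sigma> = x # xs \<and> snd ` set \<sigma> \<subseteq> set ts}"
    unfolding Cons by (fastforce simp: map_eq_Cons_conv)
  finally show ?case .
qed (auto simp: assignments_def)

definition rule_atoms :: "rule \<Rightarrow> atm list" where
  "rule_atoms r = head_list r @ pos_list r @ neg_list r"

definition subterms_of_atoms :: "atm list \<Rightarrow> trm list" where
  "subterms_of_atoms as = subterm_list (concat (map atm_args as))"

text \<open>The equation \<open>t = Var (var_name t)\<close> says that \<open>t\<close> is a
  variable, in terms of operations that are computable on codes. Repetitions are possible.\<close>

definition rule_vars :: "rule \<Rightarrow> nat list" where
  "rule_vars r = map var_name (filter (\<lambda>t. t = Var (var_name t)) (subterms_of_atoms (rule_atoms r)))"

definition constants :: "rule list \<Rightarrow> trm list" where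
  "constants rs = filter (\<lambda>t. t \<noteq> Var (var_name t) \<and> args t = [])
     (subterms_of_atoms (concat (map rule_atoms rs)))"

definition instances :: "rule list \<Rightarrow> trm list \<Rightarrow> rule list" where
  "instances rs ts = concat (map (\<lambda>r. map (\<lambda>\<sigma>. subst_rule (list_subst \<sigma>) r)
     (assignments (rule_vars r) ts)) rs)"

lemma set_rule_atoms: "set (rule_atoms r) = atoms r"
  by (auto simp: rule_atoms_def atoms_def head_def body_pos_def body_neg_def)

lemma set_subterms_of_atoms:
  "set (subterms_of_atoms as) = (\<Union>a\<in>set as. \<Union>t\<in>set (atm_args a). subterms t)"
  by (auto simp: subterms_of_atoms_def set_subterm_list)

lemma set_rule_vars: "set (rule_vars r) = vars_rule r"
proof -
  have "set (rule_vars r) = {x. Var x \<in> set (subterms_of_atoms (rule_atoms r))}"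
    by (force simp: rule_vars_def)
  moreover have "vars_atm a = {x. \<exists>t\<in>set (atm_args a). Var x \<in> subterms t}" for a
    by (cases a) (auto simp: Var_in_subterms)
  ultimately show ?thesis
    by (auto simp: vars_rule_def set_subterms_of_atoms set_rule_atoms)
qed

lemma set_constants: "set (constants rs) = {Fun f [] | f. (f, 0) \<in> funs_program (set rs)}"
proof -
  have "t \<noteq> Var (var_name t) \<and> args t = [] \<longleftrightarrow> (\<exists>f. t = Fun f [])" for t
    by (cases t) auto
  moreover have "(f, 0) \<in> funs_atm a \<longleftrightarrow> (\<exists>t\<in>set (atm_args a). Fun f [] \<in> subterms t)" for f a
    by (cases a) (simp add: Fun_in_subterms)
  ultimately show ?thesis
    by (auto simp: constants_def funs_program_def set_subterms_of_atoms set_rule_atoms)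
qed

text \<open>A variable repeated in \<open>rule_vars r\<close> may receive several values in one
  assignment; \<open>lookup\<close> takes the first of them, which is still in
  \<open>ts\<close>.\<close>

lemma set_instances:
  "set (instances rs ts) = {subst_rule \<sigma> r | \<sigma> r. r \<in> set rs \<and> \<sigma> ` vars_rule r \<subseteq> set ts}"
proof (intro equalityI subsetI)
  fix s assume "s \<in> set (instances rs ts)"
  then obtain r \<sigma> where s: "s = subst_rule (list_subst \<sigma>) r" and r: "r \<in> set rs"
    and \<sigma>: "map fst \<sigma> = rule_vars r" "snd ` set \<sigma> \<subseteq> set ts"
    by (auto simp: instances_def set_assignments)
  have "list_subst \<sigma> x \<in> set ts" if "x \<in> vars_rule r" for x
  proof -
    have "x \<in> set (map fst \<sigma>)" using that \<sigma>(1) set_rule_vars by metis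
    then show ?thesis using \<sigma>(2) lookup_mem[of x \<sigma>] by (auto simp: list_subst_def)
  qed
  then show "s \<in> {subst_rule \<sigma> r | \<sigma> r. r \<in> set rs \<and> \<sigma> ` vars_rule r \<subseteq> set ts}"
    using s r by blast
next
  fix s assume "s \<in> {subst_rule \<sigma> r | \<sigma> r. r \<in> set rs \<and> \<sigma> ` vars_rule r \<subseteq> set ts}"
  then obtain \<sigma> r where s: "s = subst_rule \<sigma> r" and r: "r \<in> set rs"
    and \<sigma>: "\<sigma> ` vars_rule r \<subseteq> set ts" by blast
  let ?\<sigma> = "map (\<lambda>x. (x, \<sigma> x)) (rule_vars r)"
  have "?\<sigma> \<in> set (assignments (rule_vars r) ts)"
    using \<sigma> by (auto simp: set_assignments set_rule_vars comp_def)
  moreover have "s = subst_rule (list_subst ?\<sigma>) r"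
    unfolding s by (rule subst_rule_cong) (simp add: list_subst_def lookup_map_Pair set_rule_vars)
  ultimately show "s \<in> set (instances rs ts)" using r by (auto simp: instances_def)
qed

section \<open>The stages that enumerate the relevant atoms\<close>

definition local_rules :: "rule list \<Rightarrow> atm list \<Rightarrow> rule list" where
  "local_rules rs as = filter (\<lambda>r. \<exists>a\<in>set (head_list r). a \<in> set as)
     (instances rs (subterms_of_atoms as @ constants rs))"

definition expand :: "rule list \<Rightarrow> atm list \<Rightarrow> atm list" where
  "expand rs as = as @ concat (map rule_atoms (local_rules rs as))"

text \<open>The candidate terms lie in the universe because relevant atoms are themselves queries;
  that they suffice for instances whose head meets \<open>as\<close> is
  \<open>matching_substitution_range\<close>.\<close>

lemma set_local_rules:
  assumes "query (set rs) Q" and fin: "finite (relevant (set rs) Q)"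
    and as: "set as \<subseteq> relevant (set rs) Q"
  shows "set (local_rules rs as) = bottom (Ground (set rs)) (set as)"
proof -
  let ?P = "set rs" and ?T = "set (subterms_of_atoms as) \<union> set (constants rs)"
  have T: "?T \<subseteq> universe ?P"
  proof -
    have "t \<in> universe ?P" if "a \<in> set as" "t \<in> set (atm_args a)" for a t
      using that as assms(1) by (blast intro: query_args relevant_query)
    then have "set (subterms_of_atoms as) \<subseteq> universe ?P"
      by (auto simp: set_subterms_of_atoms intro: universe_subterms)
    moreover have "set (constants rs) \<subseteq> universe ?P" by (auto simp: set_constants universe_def)
    ultimately show ?thesis by blast
  qed
  have range: "\<sigma> ` vars_rule r \<subseteq> ?T"
    if r: "r \<in> ?P" "\<sigma> ` vars_rule r \<subseteq> universe ?P" and h: "h \<in> head r" "subst_atm \<sigma> h \<in> set as" for \<sigma> r h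
  proof
    fix t assume "t \<in> \<sigma> ` vars_rule r"
    then obtain x where x: "x \<in> vars_rule r" "t = \<sigma> x" by blast
    have "subst_atm \<sigma> h \<in> relevant ?P Q" using h(2) as by blast
    from matching_substitution_range[OF fin r h(1) this x(1)] show "t \<in> ?T"
      using h(2) by (auto simp: x(2) set_subterms_of_atoms set_constants)
  qed
  have local: "s \<in> set (local_rules rs as) \<longleftrightarrow>
    (\<exists>\<sigma> r. s = subst_rule \<sigma> r \<and> r \<in> ?P \<and> \<sigma> ` vars_rule r \<subseteq> ?T) \<and> head s \<inter> set as \<noteq> {}" for s
    unfolding local_rules_def by (auto simp: set_instances head_def)
  have bottom: "s \<in> bottom (Ground ?P) (set as) \<longleftrightarrow>
    (\<exists>\<sigma> r. s = subst_rule \<sigma> r \<and> r \<in> ?P \<and> \<sigma> ` vars_rule r \<subseteq> universe ?P) \<and> head s \<inter> set as \<noteq> {}" for s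
    unfolding bottom_def Ground_def by auto
  have iff: "\<sigma> ` vars_rule r \<subseteq> ?T \<longleftrightarrow> \<sigma> ` vars_rule r \<subseteq> universe ?P"
    if r: "r \<in> ?P" and meets: "head (subst_rule \<sigma> r) \<inter> set as \<noteq> {}" for \<sigma> r
  proof -
    obtain h where "h \<in> head r" "subst_atm \<sigma> h \<in> set as" using meets by (auto simp: subst_rule_sets)
    then show ?thesis using T range[OF r] by blast
  qed
  show ?thesis
  proof (rule set_eqI)
    fix s
    show "s \<in> set (local_rules rs as) \<longleftrightarrow> s \<in> bottom (Ground ?P) (set as)"
    proof (cases "head s \<inter> set as = {}")
      case True
      then show ?thesis by (simp add: local bottom)
    next
      case False
      then have "s = subst_rule \<sigma> r \<and> r \<in> ?P \<and> \<sigma> ` vars_rule r \<subseteq> ?T \<longleftrightarrow>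
        s = subst_rule \<sigma> r \<and> r \<in> ?P \<and> \<sigma> ` vars_rule r \<subseteq> universe ?P" for \<sigma> r
        using iff[of r \<sigma>] by (intro conj_cong refl) simp
      then show ?thesis unfolding local bottom by (simp only:)
    qed
  qed
qed

lemma set_expand:
  assumes "query (set rs) Q" and "finite (relevant (set rs) Q)"
    and "set as \<subseteq> relevant (set rs) Q"
  shows "set (expand rs as) = set as \<union> (\<Union>r\<in>bottom (Ground (set rs)) (set as). atoms r)"
  by (simp add: expand_def set_local_rules[OF assms] set_rule_atoms)

lemma set_stage_subset:
  assumes "query (set rs) Q" and "finite (relevant (set rs) Q)"
  shows "set ((expand rs ^^ k) [Q]) \<subseteq> relevant (set rs) Q"
proof (induction k)
  case 0
  show ?case by (simp add: relevant.self)
next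
  case (Suc k)
  show ?case
    using Suc by (auto simp: set_expand[OF assms Suc] bottom_def intro: relevant.step)
qed

lemma saturated_stage_eq:
  assumes "query (set rs) Q" and "finite (relevant (set rs) Q)"
    and sat: "set (expand rs ((expand rs ^^ k) [Q])) \<subseteq> set ((expand rs ^^ k) [Q])"
  shows "set ((expand rs ^^ k) [Q]) = relevant (set rs) Q"
proof
  let ?R = "(expand rs ^^ k) [Q]"
  show sub: "set ?R \<subseteq> relevant (set rs) Q" using set_stage_subset[OF assms(1,2)] .
  show "relevant (set rs) Q \<subseteq> set ?R"
  proof
    fix a assume "a \<in> relevant (set rs) Q"
    then show "a \<in> set ?R"
    proof (induction rule: relevant.induct)
      case self
      have "Q \<in> set ((expand rs ^^ n) [Q])" for n by (induction n) (auto simp: expand_def)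
      then show ?case .
    next
      case (step a r b)
      then have "r \<in> bottom (Ground (set rs)) (set ?R)" by (auto simp: bottom_def)
      then show ?case using sat step unfolding set_expand[OF assms(1,2) sub] by blast
    qed
  qed
qed

text \<open>Unsaturated stages grow strictly, so stage \<open>k\<close> would have at least
  \<open>k\<close> atoms, for large \<open>k\<close> more than there are relevant atoms.\<close>

lemma saturated_stage_exists:
  assumes "query (set rs) Q" and "finite (relevant (set rs) Q)"
  shows "\<exists>k. set (expand rs ((expand rs ^^ k) [Q])) \<subseteq> set ((expand rs ^^ k) [Q])"
proof (rule ccontr)
  assume none: "\<not> ?thesis"
  have "k \<le> card (set ((expand rs ^^ k) [Q]))" for k
  proof (induction k)
    case (Suc k)
    have "set ((expand rs ^^ k) [Q]) \<subset> set ((expand rs ^^ Suc k) [Q])"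
      using none by (auto simp: expand_def)
    then show ?case using Suc psubset_card_mono[OF finite_set] by (metis le_less_trans Suc_leI)
  qed simp
  moreover have "card (set ((expand rs ^^ k) [Q])) \<le> card (relevant (set rs) Q)" for k
    using set_stage_subset[OF assms] assms(2) by (intro card_mono)
  ultimately show False by (meson not_less_eq_eq order_trans)
qed

section \<open>The exhaustive test on lists\<close>

text \<open>Implications are written as disjunctions and quantifiers are bounded by lists, so that
  the closure rules for \<open>computable\<close> apply directly.\<close>

definition list_sat_reduct :: "rule list \<Rightarrow> atm list \<Rightarrow> atm list \<Rightarrow> bool" where
  "list_sat_reduct G M N \<longleftrightarrow> (\<forall>r\<in>set G. (\<exists>a\<in>set (neg_list r). a \<in> set M) \<or>
     (\<exists>a\<in>set (pos_list r). a \<notin> set N) \<or> (\<exists>a\<in>set (head_list r). a \<in> set N))"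

text \<open>Lists stand for sets and may repeat entries, so a candidate \<open>N\<close> is proper
  iff \<open>set M \<subseteq> set N\<close> fails.\<close>

definition list_stable :: "rule list \<Rightarrow> atm list \<Rightarrow> bool" where
  "list_stable G M \<longleftrightarrow> list_sat_reduct G M M \<and>
     (\<forall>N\<in>set (subseqs M). set M \<subseteq> set N \<or> \<not> list_sat_reduct G M N)"

lemma list_sat_reduct_iff: "list_sat_reduct G M N \<longleftrightarrow> satisfies (set N) (reduct (set G) (set M))"
proof -
  have *: "(\<exists>a\<in>A. a \<in> B) \<longleftrightarrow> A \<inter> B \<noteq> {}" "(\<exists>a\<in>A. a \<notin> B) \<longleftrightarrow> \<not> A \<subseteq> B" for A B :: "atm set"
    by auto
  show ?thesis
    unfolding list_sat_reduct_def satisfies_reduct_iff head_def body_pos_def body_neg_def *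
    by (rule ball_cong[OF refl]) argo
qed

lemma ball_subseqs: "(\<forall>N\<in>set (subseqs M). p (set N)) \<longleftrightarrow> (\<forall>N\<in>Pow (set M). p N)"
  unfolding subseqs_powset[symmetric] by blast

lemma list_stable_iff: "list_stable G M \<longleftrightarrow> stable (set G) (set M)"
  unfolding list_stable_def list_sat_reduct_iff stable_def
  using ball_subseqs[of M "\<lambda>N. set M \<subseteq> N \<or> \<not> satisfies N (reduct (set G) (set M))"] by auto

definition list_cautious :: "rule list \<Rightarrow> atm list \<Rightarrow> atm \<Rightarrow> bool" where
  "list_cautious G R Q \<longleftrightarrow> (\<forall>M\<in>set (subseqs R). \<not> list_stable G M \<or> Q \<in> set M)"

definition list_brave :: "rule list \<Rightarrow> atm list \<Rightarrow> atm \<Rightarrow> bool" where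
  "list_brave G R Q \<longleftrightarrow> (\<exists>M\<in>set (subseqs R). list_stable G M \<and> Q \<in> set M)"

lemma entails_iff_list:
  assumes "asp_fs (set rs)" and "query (set rs) Q" and "finite (relevant (set rs) Q)"
    and R: "set R = relevant (set rs) Q"
  shows "cautiously_entails (set rs) Q \<longleftrightarrow> list_cautious (local_rules rs R) R Q"
    and "bravely_entails (set rs) Q \<longleftrightarrow> list_brave (local_rules rs R) R Q"
proof -
  have rules: "set (local_rules rs R) = bottom (Ground (set rs)) (set R)"
    by (rule set_local_rules[OF assms(2,3)]) (simp add: R)
  show "cautiously_entails (set rs) Q \<longleftrightarrow> list_cautious (local_rules rs R) R Q"
    using ball_subseqs[of R "\<lambda>M. \<not> stable (bottom (Ground (set rs)) (set R)) M \<or> Q \<in> M"]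
    unfolding entails_iff_bottom(1)[OF assms(1)] list_cautious_def list_stable_iff rules R[symmetric]
    by blast
  show "bravely_entails (set rs) Q \<longleftrightarrow> list_brave (local_rules rs R) R Q"
    using ball_subseqs[of R "\<lambda>M. \<not> (stable (bottom (Ground (set rs)) (set R)) M \<and> Q \<in> M)"]
    unfolding entails_iff_bottom(2)[OF assms(1)] list_brave_def list_stable_iff rules R[symmetric]
    by blast
qed

section \<open>Computability of the algorithm\<close>

lemma computable_enc_id:
  assumes "\<And>a. enc (h a) = enc a" and "computable f"
  shows "computable (\<lambda>x. h (f x))"
  by (rule computable_enc_cong[OF assms(2) assms(1)])

text \<open>On codes this is the identity: a pair of numbers is coded by the number that decodes to
  it.\<close>

lemma computable_prod_decode: "computable f \<Longrightarrow> computable (\<lambda>x. prod_decode (f x))"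
  by (rule computable_enc_id) (simp_all add: enc_prod_def)

text \<open>Serves functions that inspect the code by arithmetic, such as the selectors of terms,
  which branch on the tag; \<open>F\<close> has to agree with \<open>h\<close> on codes
  only.\<close>

lemma computable_via_codes:
  fixes F :: "nat \<Rightarrow> nat"
  assumes "computable F" and "\<And>a. enc (h a) = F (enc a)" and "computable f"
  shows "computable (\<lambda>x. h (f x))"
  by (rule computable_enc_cong[OF computable_comp[OF assms(1) computable_enc[OF assms(3)]]])
    (simp add: assms(2))

lemma computable_trm_selectors:
  assumes "computable f"
  shows "computable (\<lambda>x. args (f x))"
    and "computable (\<lambda>x. var_name (f x))"
    and "computable (\<lambda>x. fun_name (f x))"
proof -
  note ci = computable_intros computable_prod_decode
  have "computable (\<lambda>n. if fst (prod_decode n) = 0 then 0 else snd (prod_decode (snd (prod_decode n))))"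
    by (intro ci)
  then show "computable (\<lambda>x. args (f x))"
  proof (rule computable_via_codes[OF _ _ assms])
    show "enc (args t) = (if fst (prod_decode (enc t)) = 0 then 0
      else snd (prod_decode (snd (prod_decode (enc t)))))" for t
      by (cases t) (simp_all add: enc_Var enc_Fun enc_Nil)
  qed
  have "computable (\<lambda>n. if fst (prod_decode n) = 0 then snd (prod_decode n) else 0)"
    by (intro ci)
  then show "computable (\<lambda>x. var_name (f x))"
  proof (rule computable_via_codes[OF _ _ assms])
    show "enc (var_name t) = (if fst (prod_decode (enc t)) = 0 then snd (prod_decode (enc t)) else 0)" for t
      by (cases t) (simp_all add: enc_Var enc_Fun)
  qed
  have "computable (\<lambda>n. if fst (prod_decode n) = 0 then 0 else fst (prod_decode (snd (prod_decode n))))"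
    by (intro ci)
  then show "computable (\<lambda>x. fun_name (f x))"
  proof (rule computable_via_codes[OF _ _ assms])
    show "enc (fun_name t) = (if fst (prod_decode (enc t)) = 0 then 0
      else fst (prod_decode (snd (prod_decode (enc t)))))" for t
      by (cases t) (simp_all add: enc_Var enc_Fun)
  qed
qed

lemma computable_Var: "computable f \<Longrightarrow> computable (\<lambda>x. Var (f x))"
  by (rule computable_enc_cong[where g = "\<lambda>x. (0 :: nat, f x)"])
    (auto intro: computable_intros simp: enc_Var enc_Pair)

lemma computable_Fun: "computable f \<Longrightarrow> computable g \<Longrightarrow> computable (\<lambda>x. Fun (f x) (g x))"
  by (rule computable_enc_cong[where g = "\<lambda>x. (1 :: nat, f x, g x)"])
    (auto intro: computable_intros simp: enc_Fun enc_Pair)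

lemma computable_Atom: "computable f \<Longrightarrow> computable g \<Longrightarrow> computable (\<lambda>x. Atom (f x) (g x))"
  by (rule computable_enc_cong[where g = "\<lambda>x. (f x, g x)"])
    (auto intro: computable_intros simp: enc_Atom enc_Pair)

lemma computable_Rule:
  "computable f \<Longrightarrow> computable g \<Longrightarrow> computable h \<Longrightarrow> computable (\<lambda>x. Rule (f x) (g x) (h x))"
  by (rule computable_enc_cong[where g = "\<lambda>x. (f x, g x, h x)"])
    (auto intro: computable_intros simp: enc_Rule enc_Pair)

lemma computable_atm_selectors:
  assumes "computable f"
  shows "computable (\<lambda>x. atm_pred (f x))" and "computable (\<lambda>x. atm_args (f x))"
proof -
  have "enc (atm_pred a, atm_args a) = enc a" for a by (cases a) (simp add: enc_Atom enc_Pair)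
  from computable_enc_id[OF this assms]
  show "computable (\<lambda>x. atm_pred (f x))" "computable (\<lambda>x. atm_args (f x))"
    by (auto dest: computable_fst computable_snd)
qed

lemma computable_rule_selectors:
  assumes "computable f"
  shows "computable (\<lambda>x. head_list (f x))" and "computable (\<lambda>x. pos_list (f x))"
    and "computable (\<lambda>x. neg_list (f x))"
proof -
  have "enc (head_list r, pos_list r, neg_list r) = enc r" for r
    by (cases r) (simp add: enc_Rule enc_Pair)
  from computable_enc_id[OF this assms]
  have *: "computable (\<lambda>x. (head_list (f x), pos_list (f x), neg_list (f x)))" .
  show "computable (\<lambda>x. head_list (f x))" using computable_fst[OF *] by simp
  show "computable (\<lambda>x. pos_list (f x))" using computable_fst[OF computable_snd[OF *]] by simp
  show "computable (\<lambda>x. neg_list (f x))" using computable_snd[OF computable_snd[OF *]] by simp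
qed

lemmas computable_data_intros =
  computable_intros computable_trm_selectors computable_Var computable_Fun computable_Atom
  computable_Rule computable_atm_selectors computable_rule_selectors computable_append
  computable_concat computable_map computable_filter computable_bex_set computable_ball_set
  computable_mem_set computable_subset_set computable_subseqs

lemma computable_subterm_list: "computable f \<Longrightarrow> computable (\<lambda>x. subterm_list (f x))"
  by (rule computable_comp[of subterm_list], unfold subterm_list_def)
    (intro computable_funpow computable_data_intros)+

lemma computable_lookup:
  assumes "computable al" and "computable d" and "computable k"
  shows "computable (\<lambda>x. lookup (al x) (d x) (k x))"
  unfolding lookup_def
  by (intro computable_foldr computable_data_intros assms
      computable_comp[OF assms(3) computable_fst[OF computable_id]])

lemma computable_subst_round:
  assumes "computable \<sigma>" and "computable us" and "computable tab"
  shows "computable (\<lambda>x. subst_round (\<sigma> x) (us x) (tab x))"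
  unfolding subst_round_def
  by (intro computable_lookup computable_data_intros assms(2)
      computable_comp[OF assms(1)] computable_comp[OF assms(3)])

lemma computable_subst_trm:
  assumes "computable \<sigma>" and "computable t"
  shows "computable (\<lambda>x. subst_trm (list_subst (\<sigma> x)) (t x))"
proof (rule computable_comp2[OF _ assms])
  \<comment> \<open>The round count \<open>Suc (enc t)\<close> appears as a sum, to which
    \<open>computable_plus\<close> applies.\<close>
  have "computable (\<lambda>p. (subst_round (fst p) (subterm_list [snd p]) ^^ (1 + enc (snd p))) [])"
    by (intro computable_funpow computable_subst_round computable_subterm_list computable_plus
        computable_data_intros)
  then show "computable (\<lambda>p. subst_trm (list_subst (fst p)) (snd p))"
    unfolding subst_trm_eq_lookup
    by (intro computable_lookup computable_data_intros) simp
qed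

lemma computable_subst_atm:
  assumes "computable \<sigma>" and "computable a"
  shows "computable (\<lambda>x. subst_atm (list_subst (\<sigma> x)) (a x))"
proof -
  have "computable (\<lambda>x. Atom (atm_pred (a x)) (map (\<lambda>t. subst_trm (list_subst (\<sigma> x)) t) (atm_args (a x))))"
    by (intro computable_data_intros computable_subst_trm computable_comp[OF assms(1)] assms(2))
  moreover have "Atom (atm_pred a) (map (subst_trm \<tau>) (atm_args a)) = subst_atm \<tau> a" for \<tau> a
    by (cases a) simp
  ultimately show ?thesis by simp
qed

lemma computable_subst_rule:
  assumes "computable \<sigma>" and "computable r"
  shows "computable (\<lambda>x. subst_rule (list_subst (\<sigma> x)) (r x))"
proof -
  let ?m = "\<lambda>x as. map (\<lambda>a. subst_atm (list_subst (\<sigma> x)) a) as"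
  have "computable (\<lambda>x. Rule (?m x (head_list (r x))) (?m x (pos_list (r x))) (?m x (neg_list (r x))))"
    by (intro computable_data_intros computable_subst_atm computable_comp[OF assms(1)] assms(2))
  moreover have "Rule (map (subst_atm \<tau>) (head_list r)) (map (subst_atm \<tau>) (pos_list r))
      (map (subst_atm \<tau>) (neg_list r)) = subst_rule \<tau> r" for \<tau> r
    by (cases r) simp
  ultimately show ?thesis by simp
qed

lemma computable_assignments:
  assumes "computable xs" and "computable ts"
  shows "computable (\<lambda>x. assignments (xs x) (ts x))"
  unfolding assignments_def
  by (intro computable_foldr computable_data_intros assms(1) computable_comp[OF assms(2)])

lemma computable_rule_atoms: "computable r \<Longrightarrow> computable (\<lambda>x. rule_atoms (r x))"
  unfolding rule_atoms_def by (intro computable_data_intros)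

lemma computable_subterms_of_atoms: "computable f \<Longrightarrow> computable (\<lambda>x. subterms_of_atoms (f x))"
  unfolding subterms_of_atoms_def by (intro computable_subterm_list computable_data_intros)

lemma computable_rule_vars: "computable r \<Longrightarrow> computable (\<lambda>x. rule_vars (r x))"
  unfolding rule_vars_def
  by (intro computable_subterms_of_atoms computable_rule_atoms computable_data_intros)

lemma computable_constants: "computable rs \<Longrightarrow> computable (\<lambda>x. constants (rs x))"
  unfolding constants_def
  by (intro computable_subterms_of_atoms computable_rule_atoms computable_data_intros)

lemma computable_instances:
  assumes "computable rs" and "computable ts"
  shows "computable (\<lambda>x. instances (rs x) (ts x))"
  unfolding instances_def
  by (intro computable_subst_rule computable_assignments computable_rule_vars
      computable_data_intros assms(1) computable_comp[OF assms(2)])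

lemma computable_local_rules:
  assumes "computable rs" and "computable as"
  shows "computable (\<lambda>x. local_rules (rs x) (as x))"
  unfolding local_rules_def
  by (intro computable_instances computable_subterms_of_atoms computable_constants
      computable_data_intros assms computable_comp[OF assms(2)])

lemma computable_expand:
  assumes "computable rs" and "computable as"
  shows "computable (\<lambda>x. expand (rs x) (as x))"
  unfolding expand_def
  by (intro computable_local_rules computable_rule_atoms computable_data_intros assms)

lemma computable_list_sat_reduct:
  assumes "computable G" and "computable M" and "computable N"
  shows "computable (\<lambda>x. list_sat_reduct (G x) (M x) (N x))"
  unfolding list_sat_reduct_def
  by (intro computable_data_intros assms(1) computable_comp[OF assms(2)] computable_comp[OF assms(3)])

lemma computable_list_stable:
  assumes "computable G" and "computable M"
  shows "computable (\<lambda>x. list_stable (G x) (M x))"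
  unfolding list_stable_def
  by (intro computable_list_sat_reduct computable_data_intros assms
      computable_comp[OF assms(1)] computable_comp[OF assms(2)])

lemma computable_list_entails:
  assumes "computable G" and "computable R" and "computable Q"
  shows "computable (\<lambda>x. list_cautious (G x) (R x) (Q x))"
    and "computable (\<lambda>x. list_brave (G x) (R x) (Q x))"
  unfolding list_cautious_def list_brave_def
  by (intro computable_list_stable computable_data_intros assms(2)
      computable_comp[OF assms(1)] computable_comp[OF assms(3)])+

lemma computable_stage:
  "computable (\<lambda>p :: nat \<times> rule list \<times> atm. (expand (fst (snd p)) ^^ fst p) [snd (snd p)])"
  by (intro computable_funpow computable_expand computable_data_intros)

text \<open>The search for the relevant atoms is shared by both modes of entailment; only the final
  test \<open>E\<close> differs.\<close>

lemma decides_finitely_recursive_if_computable: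
  assumes E: "computable (\<lambda>p :: rule list \<times> atm list \<times> atm. E (fst p) (fst (snd p)) (snd (snd p)))"
    and entails: "\<And>rs R Q. \<lbrakk>asp_fs (set rs); query (set rs) Q; finite (relevant (set rs) Q);
      set R = relevant (set rs) Q\<rbrakk> \<Longrightarrow> entails (set rs) Q \<longleftrightarrow> E (local_rules rs R) R Q"
  shows "\<exists>f. decides_finitely_recursive f entails"
proof -
  define stage where "stage rs Q k = (expand rs ^^ k) [Q]" for rs Q and k :: nat
  define saturated where "saturated rs Q k \<longleftrightarrow>
    set (expand rs (stage rs Q k)) \<subseteq> set (stage rs Q k)" for rs Q k
  \<comment> \<open>Negated, because \<open>Mu\<close> stops at 0, which is the code of
    \<open>False\<close>.\<close>
  have "computable (\<lambda>p :: nat \<times> rule list \<times> atm. \<not> saturated (fst (snd p)) (snd (snd p)) (fst p))"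
    unfolding saturated_def stage_def
    by (intro computable_expand computable_stage computable_data_intros)
  then obtain g where g: "\<And>p :: nat \<times> rule list \<times> atm.
      computes g [enc p] (enc (\<not> saturated (fst (snd p)) (snd (snd p)) (fst p)))"
    unfolding computable_def by blast
  have "computable (\<lambda>p :: nat \<times> rule list \<times> atm.
      E (local_rules (fst (snd p)) (stage (fst (snd p)) (snd (snd p)) (fst p)))
      (stage (fst (snd p)) (snd (snd p)) (fst p)) (snd (snd p)))"
    unfolding stage_def
    using computable_comp[OF E, where g = "\<lambda>p :: nat \<times> rule list \<times> atm.
      (local_rules (fst (snd p)) ((expand (fst (snd p)) ^^ fst p) [snd (snd p)]),
      (expand (fst (snd p)) ^^ fst p) [snd (snd p)], snd (snd p))"]
    by (simp add: computable_Pair computable_local_rules computable_stage computable_fst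
        computable_snd computable_id)
  then obtain h where h: "\<And>p :: nat \<times> rule list \<times> atm. computes h [enc p]
      (enc (E (local_rules (fst (snd p)) (stage (fst (snd p)) (snd (snd p)) (fst p)))
        (stage (fst (snd p)) (snd (snd p)) (fst p)) (snd (snd p))))"
    unfolding computable_def by blast
  define search where "search = Mu (Comp g [Comp pair_recf [Proj 0, Comp pair_recf [Proj 1, Proj 2]]])"
  define f where "f = Comp h [Comp pair_recf [search, pair_recf]]"
  have "computes f [code_program rs, code_atm Q] (if entails (set rs) Q then 1 else 0)"
    if asp: "asp_fs (set rs)" and query: "query (set rs) Q" and fr: "finitely_recursive (set rs) Q" for rs Q
  proof -
    have fin: "finite (relevant (set rs) Q)" using fr by (simp add: finitely_recursive_def)
    have ex: "\<exists>k. saturated rs Q k"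
      unfolding saturated_def stage_def using query fin by (rule saturated_stage_exists)
    \<comment> \<open>\<open>Mu\<close> returns the least zero, and only if all earlier values exist
      and are positive, hence the least saturated stage.\<close>
    define k where "k = (LEAST k. saturated rs Q k)"
    have k: "saturated rs Q k" unfolding k_def using ex by (rule LeastI_ex)
    have k_min: "\<not> saturated rs Q m" if "m < k" for m
      using not_less_Least that unfolding k_def by blast
    have R: "set (stage rs Q k) = relevant (set rs) Q"
      using saturated_stage_eq[OF query fin, of k] k by (simp add: saturated_def stage_def)
    let ?test = "Comp g [Comp pair_recf [Proj 0, Comp pair_recf [Proj 1, Proj 2]]]"
    have test: "computes ?test [m, enc rs, enc Q] (enc (\<not> saturated rs Q m))" for m
    proof (rule computes_Comp1)
      show "computes (Comp pair_recf [Proj 0, Comp pair_recf [Proj 1, Proj 2]]) [m, enc rs, enc Q] (enc (m, rs, Q))"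
        unfolding enc_Pair by (auto intro!: computes_Comp2 computes_Proj computes_pair)
      show "computes g [enc (m, rs, Q)] (enc (\<not> saturated rs Q m))" using g[of "(m, rs, Q)"] by simp
    qed
    have "computes search [enc rs, enc Q] k"
      unfolding search_def
    proof (intro computes.mu allI impI exI)
      show "computes ?test [k, enc rs, enc Q] 0" using test[of k] k by (simp add: enc_bool_def)
      show "computes ?test [m, enc rs, enc Q] (Suc 0)" if "m < k" for m
        using test[of m] k_min[OF that] by (simp add: enc_bool_def)
    qed
    then have "computes (Comp pair_recf [search, pair_recf]) [enc rs, enc Q] (enc (k, rs, Q))"
      unfolding enc_Pair by (auto intro!: computes_Comp2 computes_pair)
    then have "computes f [enc rs, enc Q] (enc (E (local_rules rs (stage rs Q k)) (stage rs Q k) Q))"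
      unfolding f_def using h[of "(k, rs, Q)"] by (auto intro: computes_Comp1)
    then show ?thesis
      unfolding code_program_eq_enc code_atm_eq_enc entails[OF asp query fin R, symmetric]
      by (simp add: enc_bool_def)
  qed
  then show ?thesis unfolding decides_finitely_recursive_def by blast
qed

theorem theorem5:
  "(\<exists>f. decides_finitely_recursive f cautiously_entails) \<and>
   (\<exists>f. decides_finitely_recursive f bravely_entails)"
proof
  show "\<exists>f. decides_finitely_recursive f cautiously_entails"
  proof (rule decides_finitely_recursive_if_computable)
    show "computable (\<lambda>p :: rule list \<times> atm list \<times> atm. list_cautious (fst p) (fst (snd p)) (snd (snd p)))"
      by (intro computable_list_entails computable_intros)
  qed (rule entails_iff_list)
  show "\<exists>f. decides_finitely_recursive f bravely_entails"
  proof (rule decides_finitely_recursive_if_computable)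
    show "computable (\<lambda>p :: rule list \<times> atm list \<times> atm. list_brave (fst p) (fst (snd p)) (snd (snd p)))"
      by (intro computable_list_entails computable_intros)
  qed (rule entails_iff_list)
qed

end
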